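(* Let $q=p^k$ be a prime power (with $p$ prime and $k\ge 1$), let $n\ge 1$ be an integer, and let $f:\mathbb{F}_q\to\mathbb{F}_q$ be a function. Then $f$ preserves positive definiteness on $M_n(\mathbb{F}_q)$ precisely in the following cases (that is, in each of the cases below, which together cover all pairs $(n,q)$, $f$ preserves positive definiteness on $M_n(\mathbb{F}_q)$ if and only if the stated condition on $f$ holds). \begin{enumerate} \item If $n=1$: $f(\mathbb{F}_q^+)\subseteq\mathbb{F}_q^+$. \item If $n=2$ and $q$ is even: $f$ is a bijective monomial, i.e. there exist $c\in\mathbb{F}_q^\times$ and an integer $m$ with $1\le m\le q-1$ and $\gcd(m,q-1)=1$ such that $f(x)=cx^m$ for all $x\in\mathbb{F}_q$. \item If $n\ge 3$ and $q$ is even: there exist $c\in\mathbb{F}_q^\times$ and an integer $0\le j\le k-1$ such that $f(x)=cx^{2^j}$ for all $x\in\mathbb{F}_q$. \item If $n\ge 2$ and $q$ is odd: there exist $c\in\mathbb{F}_q^+$ and an integer $0\le j\le k-1$ such that $f(x)=cx^{p^j}$ for all $x\in\mathbb{F}_q$. \end{enumerate}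
   Context: $\mathbb{F}_q$ denotes the finite field with $q$ elements and $\mathbb{F}_q^\times=\mathbb{F}_q\setminus\{0\}$. $\mathbb{F}_q^+:=\{x^2:x\in\mathbb{F}_q^\times\}$ is the set of nonzero squares. $M_n(\mathbb{F}_q)$ is the set of $n\times n$ matrices over $\mathbb{F}_q$. A matrix $A\in M_n(\mathbb{F}_q)$ is called positive definite if it is symmetric and all its leading principal minors (the determinants of its upper-left $r\times r$ submatrices, $1\le r\le n$) belong to $\mathbb{F}_q^+$. For a function $f:\mathbb{F}_q\to\mathbb{F}_q$ and $A=(a_{ij})\in M_n(\mathbb{F}_q)$, $f[A]:=(f(a_{ij}))$ denotes the matrix obtained by applying $f$ entrywise. The function $f$ preserves positive definiteness on $M_n(\mathbb{F}_q)$ (is an entrywise positivity preserver) if $f[A]$ is positive definite whenever $A\in M_n(\mathbb{F}_q)$ is positive definite. *)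

theory Defs
  imports
    Jordan_Normal_Form.Determinant
    Jordan_Normal_Form.DL_Submatrix
    "HOL-Computational_Algebra.Primes"
begin

definition nonzero_squares :: "'a :: field set" where
  "nonzero_squares = {x ^ 2 | x. x \<noteq> 0}"

definition leading_principal_minor :: "'a :: comm_ring_1 mat \<Rightarrow> nat \<Rightarrow> 'a" where
  "leading_principal_minor A r = det (submatrix A {..<r} {..<r})"

definition positive_definite :: "nat \<Rightarrow> 'a :: field mat \<Rightarrow> bool" where
  "positive_definite n A \<longleftrightarrow>
     A \<in> carrier_mat n n \<and> transpose_mat A = A \<and>
     (\<forall>r\<in>{1..n}. leading_principal_minor A r \<in> nonzero_squares)"

definition preserves_positive_definiteness :: "nat \<Rightarrow> ('a :: field \<Rightarrow> 'a) \<Rightarrow> bool" where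
  "preserves_positive_definiteness n f \<longleftrightarrow>
     (\<forall>A. positive_definite n A \<longrightarrow> positive_definite n (map_mat f A))"

lemma pick_lessThan: "i < r \<Longrightarrow> pick {..<r} i = i"
proof (induction i)
  case 0
  then show ?case by (auto intro!: Least_equality)
next
  case (Suc i)
  then show ?case by (auto intro!: Least_equality)
qed

lemma submatrix_lessThan:
  assumes "A \<in> carrier_mat n n" "r \<le> n"
  shows "submatrix A {..<r} {..<r} = mat r r (\<lambda>(i, j). A $$ (i, j))"
proof -
  have "{i. i < n \<and> i \<in> {..<r}} = {..<r}"
    using assms(2) by auto
  then show ?thesis
    using assms(1) by (intro eq_matI) (auto simp: submatrix_def pick_lessThan)
qed

end

theory Submission
  imports Defs "HOL-Library.Cardinality"
begin

text \<open>
  Bordering by an identity matrix reduces the necessity of the conditions to \<open>n \<le> 3\<close>. Let \<open>q\<close> be odd and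
  let \<open>f\<close> preserve positive definiteness for \<open>n = 2\<close>. Some iterate of \<open>f\<close> is idempotent; comparing square
  differences shows that it is the identity, so \<open>f\<close> is bijective. After normalization to \<open>f 1 = 1\<close>, \<open>f\<close> is
  multiplicative, hence \<open>f x = x ^ d\<close>, and all quotients \<open>(f x - f y) / (x - y)\<close> are nonzero squares.
  Since so few directions are determined by the graph of \<open>f\<close>, Redei's lacunary polynomials (as in Carlitz's
  theorem) force \<open>d\<close> to be a power of \<open>p\<close>. If \<open>q\<close> is even, every element is a square. Then positivity for
  \<open>n = 2\<close> only says \<open>a * c \<noteq> b ^ 2\<close>, which makes \<open>f\<close> injective and multiplicative up to a factor, and
  \<open>n = 3\<close> gives additivity.
\<close>

section \<open>Power sums and multiplicative maps\<close>

text \<open>Preservation is a one-way implication, and in odd characteristic nothing makes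
  \<open>f\<close> injective at the outset. An idempotent iterate helps because every value of it is
  a fixed point, so that \<open>x\<close> can be compared with its image; elsewhere, counting turns
  inclusions into equalities. The nonzero squares are just under half of the field. This is used
  twice: together with zero they are enough points to tell two elements apart by square differences,
  and as directions they stay below the threshold q / 2 of the lacunary argument. In characteristic
  two a 2 by 2 determinant sees only the relation \<open>a * c = b ^ 2\<close>, which every
  injective power map respects; addition first enters with the 3 by 3 determinant, so
  \<open>n = 2\<close> is exceptional there.\<close>

lemma of_nat_card_UNIV: "of_nat CARD('a) = (0 :: 'a :: {ring_1, finite})"
proof -
  have "(\<Sum>x\<in>UNIV. x + 1 :: 'a) = (\<Sum>x\<in>UNIV. x)"
    by (rule sum.reindex_bij_witness[of _ "\<lambda>x. x - 1" "\<lambda>x. x + 1"]) auto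
  then show ?thesis
    by (simp add: sum.distrib)
qed

lemma power_card_minus_1:
  fixes x :: "'a :: {field, finite}"
  assumes "x \<noteq> 0"
  shows "x ^ (CARD('a) - 1) = 1"
proof -
  have "(\<Prod>y\<in>UNIV - {0 :: 'a}. x * y) = (\<Prod>y\<in>UNIV - {0}. y)"
    using assms by (intro prod.reindex_bij_witness[of _ "\<lambda>y. y / x" "\<lambda>y. x * y"]) auto
  moreover have "(\<Prod>y\<in>UNIV - {0 :: 'a}. y) \<noteq> 0"
    by simp
  ultimately show ?thesis
    by (simp add: prod.distrib card_Diff_singleton)
qed

lemma power_card:
  fixes x :: "'a :: {field, finite}"
  shows "x ^ CARD('a) = x"
proof (cases "x = 0")
  case False
  then show ?thesis
    using power_minus_mult[of "CARD('a)" x] power_card_minus_1[OF False]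
    by (simp add: finite_UNIV_card_ge_0)
qed (simp add: power_0_left)

lemma card_UNIV_ge_2: "CARD('a :: {zero_neq_one, finite}) \<ge> 2"
proof -
  have "card {0, 1 :: 'a} \<le> CARD('a)"
    by (rule card_mono) auto
  then show ?thesis
    by simp
qed

text \<open>Replacing \<open>x\<close> by \<open>y * x\<close> multiplies the sum by
  \<open>y ^ j\<close>, and some nonzero \<open>y\<close> has \<open>y ^ j\<close> different from 1,
  since \<open>X ^ j - 1\<close> has at most \<open>j\<close> roots.\<close>

lemma sum_power_eq_0:
  assumes "1 \<le> j" "j < CARD('a :: {field, finite}) - 1"
  shows "(\<Sum>x\<in>UNIV. x ^ j) = (0 :: 'a)"
proof -
  have "\<exists>y :: 'a. y \<noteq> 0 \<and> y ^ j \<noteq> 1"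
  proof (rule ccontr)
    assume *: "\<not> ?thesis"
    let ?P = "monom (1 :: 'a) j - 1"
    have "?P \<noteq> 0"
      using assms(1) by (auto simp: poly_eq_iff intro!: exI[of _ j])
    then have "card {x. poly ?P x = 0} \<le> degree ?P"
      by (rule card_poly_roots_bound)
    also have "degree ?P \<le> j"
      by (intro degree_diff_le) (auto simp: degree_monom_le)
    finally have "card {x. poly ?P x = 0} \<le> j" .
    moreover have "card (UNIV - {0 :: 'a}) \<le> card {x. poly ?P x = 0}"
      using * by (intro card_mono) (auto simp: poly_monom)
    ultimately show False
      using assms(2) by (simp add: card_Diff_singleton)
  qed
  then obtain y :: 'a where y: "y \<noteq> 0" "y ^ j \<noteq> 1"
    by blast
  have "(\<Sum>x\<in>UNIV. (y * x) ^ j) = (\<Sum>x\<in>UNIV. x ^ j)"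
    using y by (intro sum.reindex_bij_witness[of _ "\<lambda>x. x / y" "\<lambda>x. y * x"]) auto
  then have "(y ^ j - 1) * (\<Sum>x\<in>UNIV. x ^ j) = 0"
    by (simp add: power_mult_distrib left_diff_distrib flip: sum_distrib_left)
  then show ?thesis
    using y by simp
qed

lemma sum_power_card_minus_1: "(\<Sum>x\<in>UNIV. x ^ (CARD('a) - 1)) = (-1 :: 'a :: {field, finite})"
proof -
  have "(\<Sum>x\<in>UNIV. x ^ (CARD('a) - 1)) = (\<Sum>x\<in>UNIV - {0 :: 'a}. 1 :: 'a)"
    using card_UNIV_ge_2[where 'a = 'a]
    by (subst sum.mono_neutral_cong_right[of UNIV "UNIV - {0}" _ "\<lambda>_. 1"])
      (simp_all add: power_0_left power_card_minus_1 del: One_nat_def)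
  also have "\<dots> + 1 = of_nat CARD('a)"
    using card_UNIV_ge_2[where 'a = 'a] of_nat_Suc[of "CARD('a) - 1", where 'a = 'a]
    by (simp add: card_Diff_singleton)
  finally show ?thesis
    by (simp add: of_nat_card_UNIV eq_neg_iff_add_eq_0)
qed

text \<open>
  Up to sign, \<open>c d\<close> below is the coefficient of \<open>x ^ d\<close> in the interpolation polynomial of \<open>g\<close>.
  Multiplicativity forces \<open>c d * (g y - y ^ d) = 0\<close>, so one nonzero coefficient suffices.
\<close>
lemma multiplicative_imp_power:
  fixes g :: "'a :: {field, finite} \<Rightarrow> 'a"
  assumes mult: "\<And>x y. g (x * y) = g x * g y" and "g 0 = 0" "g 1 = 1"
  shows "\<exists>d. 1 \<le> d \<and> d \<le> CARD('a) - 1 \<and> (\<forall>x. g x = x ^ d)"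
proof -
  define n where "n = CARD('a) - 1"
  have card: "CARD('a) = Suc n" and "n \<ge> 1"
    using card_UNIV_ge_2[where 'a = 'a] by (auto simp: n_def)
  have pow_n: "x ^ n = 1" if "x \<noteq> 0" for x :: 'a
    using power_card_minus_1[OF that] by (simp add: n_def)
  define c where "c d = (\<Sum>u\<in>UNIV. g u * u ^ (n - d))" for d
  \<comment> \<open>The sum has as many terms as the field has elements, hence vanishes at
    \<open>u = 1\<close>; otherwise \<open>u ^ CARD('a) = u\<close> makes the geometric series equal
    to 1.\<close>
  have geo: "(\<Sum>d\<le>n. u ^ (n - d)) = (if u = 1 then 0 else 1)" for u :: 'a
  proof -
    have "(\<Sum>d\<le>n. u ^ (n - d)) = (\<Sum>d\<le>n. u ^ d)"
      by (rule sum.reindex_bij_witness[of _ "\<lambda>d. n - d" "\<lambda>d. n - d"]) auto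
    moreover have "(1 - u) * (\<Sum>d\<le>n. u ^ d) = 1 - u"
      using power_card[of u] card by (simp add: sum_gp_basic)
    moreover have "(\<Sum>d\<le>n. 1) = (0 :: 'a)"
      using of_nat_card_UNIV[where 'a = 'a] card by simp
    ultimately show ?thesis
      by (cases "u = 1") auto
  qed
  have "(\<Sum>d\<le>n. c d) = (\<Sum>u\<in>UNIV. g u * (\<Sum>d\<le>n. u ^ (n - d)))"
    unfolding c_def by (subst sum.swap) (simp add: sum_distrib_left)
  also have "\<dots> = (\<Sum>u\<in>UNIV - {1}. g u)"
    unfolding geo by (intro sum.mono_neutral_cong_right) auto
  also have "\<dots> = (\<Sum>u\<in>UNIV. g u) - g 1"
    by (simp add: sum_diff1)
  also have "(\<Sum>u\<in>UNIV. g u) = c 0"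
    unfolding c_def
  proof (intro sum.cong refl)
    show "g u = g u * u ^ (n - 0)" for u
      using assms(2) pow_n[of u] by (cases "u = 0") auto
  qed
  also have "(\<Sum>d\<le>n. c d) = c 0 + (\<Sum>d\<in>{1..n}. c d)"
  proof -
    have "{..n} = insert 0 {1..n}"
      by auto
    then show ?thesis
      by simp
  qed
  finally have "(\<Sum>d\<in>{1..n}. c d) \<noteq> 0"
    using assms(3) by simp
  then obtain d where d: "d \<in> {1..n}" "c d \<noteq> 0"
    by (rule sum.not_neutral_contains_not_neutral)
  have "g y = y ^ d" for y
  proof (cases "y = 0")
    case False
    have *: "y ^ d * y ^ (n - d) = 1"
      using pow_n[OF False] d(1) by (simp flip: power_add)
    have "g y * c d = (\<Sum>u\<in>UNIV. g (y * u) * u ^ (n - d))"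
      by (simp add: c_def mult sum_distrib_left mult.assoc)
    also have "\<dots> = (\<Sum>u\<in>UNIV. y ^ d * (g (y * u) * (y * u) ^ (n - d)))"
    proof (intro sum.cong refl)
      fix u
      have "y ^ d * (g (y * u) * (y * u) ^ (n - d)) = (y ^ d * y ^ (n - d)) * (g (y * u) * u ^ (n - d))"
        by (simp only: power_mult_distrib mult_ac)
      then show "g (y * u) * u ^ (n - d) = y ^ d * (g (y * u) * (y * u) ^ (n - d))"
        by (simp only: * mult_1_left)
    qed
    also have "\<dots> = (\<Sum>u\<in>UNIV. y ^ d * (g u * u ^ (n - d)))"
      using False
      by (intro sum.reindex_bij_witness[of _ "\<lambda>x. x / y" "\<lambda>x. y * x"]) auto
    also have "\<dots> = y ^ d * c d"
      by (simp only: c_def sum_distrib_left)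
    finally show ?thesis
      using d(2) by simp
  next
    case True
    then show ?thesis
      using assms(2) d(1) by (simp add: power_0_left)
  qed
  with d(1) show ?thesis
    by (intro exI[of _ d]) (simp add: n_def)
qed

section \<open>Maps determining few directions\<close>

lemma prod_linear_degree:
  "degree (\<Prod>x\<in>A. [:- h x, 1:]) = card A" "coeff (\<Prod>x\<in>A. [:- h x, 1:]) (card A) = 1"
  for h :: "'b \<Rightarrow> 'a :: field"
proof -
  show deg: "degree (\<Prod>x\<in>A. [:- h x, 1:]) = card A"
    by (subst degree_prod_sum_eq) simp_all
  show "coeff (\<Prod>x\<in>A. [:- h x, 1:]) (card A) = 1"
    using lead_coeff_prod[of "\<lambda>x. [:- h x, 1:]" A] by (simp add: deg)
qed

lemma prod_linear_UNIV:
  "(\<Prod>c\<in>UNIV. [:- c, 1:]) = monom 1 CARD('a) - [:0, 1 :: 'a :: {field, finite}:]"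
\<comment> \<open>Both sides have degree q, one too much for agreement at q points to decide; equal
  leading coefficients close the gap.\<close>
proof (rule poly_eqI_degree_lead_coeff[of _ "CARD('a)" _ UNIV])
  have "\<not> CARD('a) \<le> Suc 0"
    using card_UNIV_ge_2[where 'a = 'a] by simp
  then show "coeff (\<Prod>c\<in>UNIV. [:- c, 1:]) CARD('a) =
      coeff (monom 1 CARD('a) - [:0, 1 :: 'a:]) CARD('a)"
    using prod_linear_degree(2)[of "\<lambda>c :: 'a. c" UNIV] by (simp add: coeff_pCons split: nat.split)
  show "degree (monom 1 CARD('a) - [:0, 1 :: 'a:]) \<le> CARD('a)"
    using card_UNIV_ge_2[where 'a = 'a]
    by (intro degree_diff_le degree_monom_le) simp
  show "poly (\<Prod>c\<in>UNIV. [:- c, 1:]) z = poly (monom 1 CARD('a) - [:0, 1 :: 'a:]) z" for z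
    by (simp add: poly_prod poly_monom power_card)
qed (simp_all add: prod_linear_degree)

text \<open>The product has total degree at most \<open>card A\<close> in its variable and
  \<open>y\<close> together. Coefficients with \<open>i > card A\<close> are zero, and as the zero
  polynomial has degree 0, the bound has to exclude it.\<close>

lemma coeff_prod_linear_degree:
  fixes f k :: "'b \<Rightarrow> 'a :: field"
  assumes "finite A"
  shows "\<exists>P. (\<forall>y. coeff (\<Prod>x\<in>A. [:- (f x - k x * y), 1:]) i = poly P y) \<and>
    (P \<noteq> 0 \<longrightarrow> degree P + i \<le> card A)"
  using assms
proof (induction A arbitrary: i rule: finite_induct)
  case empty
  then show ?case
    by (intro exI[of _ "if i = 0 then 1 else 0"]) auto
next
  case (insert a A)
  let ?Q = "\<lambda>y. \<Prod>x\<in>A. [:- (f x - k x * y), 1:]"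
  have step: "\<exists>P. (\<forall>y. coeff ([:- (f a - k a * y), 1:] * ?Q y) i = poly P y) \<and>
    (P \<noteq> 0 \<longrightarrow> degree P + i \<le> Suc (card A))"
  proof -
    obtain P where P: "\<And>y. coeff (?Q y) i = poly P y" "P \<noteq> 0 \<longrightarrow> degree P + i \<le> card A"
      using insert.IH by blast
    have deg: "degree ([:- f a, k a:] * P) + i \<le> Suc (card A) \<or> P = 0"
      using P(2) degree_mult_le[of "[:- f a, k a:]" P] by (auto split: if_splits)
    show ?thesis
    proof (cases i)
      case 0
      have "coeff ([:- (f a - k a * y), 1:] * ?Q y) i = poly ([:- f a, k a:] * P) y" for y
        using P(1)[of y] by (simp add: 0 algebra_simps)
      moreover have "[:- f a, k a:] * P \<noteq> 0 \<longrightarrow> degree ([:- f a, k a:] * P) + i \<le> Suc (card A)"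
        using deg by auto
      ultimately show ?thesis
        by blast
    next
      case (Suc i')
      obtain P' where P': "\<And>y. coeff (?Q y) i' = poly P' y" "P' \<noteq> 0 \<longrightarrow> degree P' + i' \<le> card A"
        using insert.IH by blast
      have "coeff ([:- (f a - k a * y), 1:] * ?Q y) i = poly ([:- f a, k a:] * P + P') y" for y
        using P(1)[of y] P'(1)[of y] by (simp add: Suc algebra_simps)
      moreover have "degree ([:- f a, k a:] * P + P') + i \<le> Suc (card A)"
        if "[:- f a, k a:] * P + P' \<noteq> 0"
      proof -
        have "degree P' + i \<le> Suc (card A) \<or> P' = 0"
          using P'(2) Suc by auto
        with deg that show ?thesis
          using degree_add_le_max[of "[:- f a, k a:] * P" P'] by auto
      qed
      ultimately show ?thesis
        by blast
    qed
  qed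
  then show ?case
    using insert.hyps by simp
qed

text \<open>
  The idea is due to Redei: a product of linear factors \<open>R\<close> divides \<open>(X ^ q - X) * pderiv R\<close>, which is
  congruent modulo \<open>R\<close> to \<open>- (g + X) * pderiv g\<close>, a polynomial of smaller degree.
\<close>
lemma fully_reducible_lacunary:
  fixes h :: "'a :: {field, finite} \<Rightarrow> 'a"
  assumes R: "(\<Prod>x\<in>UNIV. [:- h x, 1:]) = monom 1 CARD('a) + g"
    and "degree g \<le> m" "1 \<le> m" "2 * m \<le> CARD('a)"
  shows "g = - [:0, 1:] \<or> pderiv g = 0"
proof (rule ccontr)
  assume *: "\<not> ?thesis"
  let ?R = "\<Prod>x\<in>UNIV. [:- h x, 1:]"
  let ?F = "\<Prod>c\<in>UNIV. [:- c, 1 :: 'a:]"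
  have "pderiv ?R = pderiv g"
    unfolding R by (simp add: pderiv_add pderiv_monom of_nat_card_UNIV)
  moreover have "?R dvd ?F * pderiv ?R"
  proof -
    \<comment> \<open>Every summand of the derivative lacks one linear factor of \<open>?R\<close>,
      and that factor divides \<open>?F\<close>.\<close>
    have "?R dvd ?F * ((\<Prod>x\<in>UNIV - {a}. [:- h x, 1:]) * pderiv [:- h a, 1:])" for a
    proof -
      have "?R = [:- h a, 1:] * (\<Prod>x\<in>UNIV - {a}. [:- h x, 1:])"
        by (rule prod.remove) auto
      moreover have "[:- h a, 1:] dvd ?F"
        by (rule dvd_prodI) auto
      moreover have "pderiv [:- h a, 1:] = 1"
        by (simp add: pderiv_pCons)
      ultimately show ?thesis
        by (metis dvd_refl mult.right_neutral mult_dvd_mono)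
    qed
    then show ?thesis
      unfolding pderiv_prod sum_distrib_left by (intro dvd_sum) auto
  qed
  ultimately have "?R dvd ?F * pderiv g"
    by simp
  moreover have "?F = ?R - (g + [:0, 1:])"
    unfolding prod_linear_UNIV R by simp
  ultimately have "?R dvd ?R * pderiv g - (g + [:0, 1:]) * pderiv g"
    by (simp only: left_diff_distrib)
  then have "?R dvd (g + [:0, 1:]) * pderiv g"
    by (simp add: dvd_diff_right_iff)
  moreover have "g + [:0, 1:] \<noteq> 0" "pderiv g \<noteq> 0"
    using * unfolding eq_neg_iff_add_eq_0 by auto
  ultimately have "degree ?R \<le> degree (g + [:0, 1:]) + degree (pderiv g)"
    by (metis degree_mult_eq dvd_imp_degree_le no_zero_divisors)
  moreover have "degree (g + [:0, 1:]) \<le> m"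
    using assms by (intro degree_add_le) auto
  moreover have "degree (pderiv g) \<le> m - 1"
    using assms(2) by (intro degree_le) (auto simp: coeff_pderiv coeff_eq_0)
  ultimately show False
    using assms(3,4) by (simp add: prod_linear_degree)
qed

text \<open>A vanishing derivative makes the multiplicity of every root a multiple of the
  characteristic, so each value of \<open>h\<close> contributes zero to the sum.\<close>

lemma sum_eq_0_if_pderiv_eq_0:
  fixes h k :: "'a :: {field, finite} \<Rightarrow> 'a"
  assumes "pderiv (\<Prod>x\<in>UNIV. [:- h x, 1:]) = 0"
  shows "(\<Sum>x\<in>UNIV. k (h x)) = 0"
proof -
  have card: "of_nat (card {x. h x = c}) = (0 :: 'a)" for c
  proof (cases "card {x. h x = c}")
    case (Suc t)
    define Q where "Q = (\<Prod>x\<in>-{x. h x = c}. [:- h x, 1:])"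
    have "(\<Prod>x\<in>UNIV. [:- h x, 1:]) = (\<Prod>x\<in>{x. h x = c}. [:- h x, 1:]) * Q"
      unfolding Q_def by (subst prod.union_disjoint[symmetric]) auto
    also have "(\<Prod>x\<in>{x. h x = c}. [:- h x, 1:]) = [:- c, 1:] ^ Suc t"
      using Suc by simp
    finally have "0 = [:- c, 1:] ^ t * ([:- c, 1:] * pderiv Q + smult (of_nat (Suc t)) Q)"
      using assms by (simp only: pderiv_mult pderiv_power_Suc) (simp add: pderiv_pCons algebra_simps)
    then have "poly ([:- c, 1:] * pderiv Q + smult (of_nat (Suc t)) Q) c = 0"
      by simp
    moreover have "poly Q c \<noteq> 0"
      by (auto simp: Q_def poly_prod)
    ultimately show ?thesis
      using Suc by simp
  qed simp
  have "(\<Sum>x\<in>UNIV. k (h x)) = (\<Sum>c\<in>UNIV. \<Sum>x\<in>{x \<in> UNIV. h x = c}. k (h x))"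
    by (rule sum.group[symmetric]) auto
  also have "\<dots> = (\<Sum>c\<in>UNIV. of_nat (card {x. h x = c}) * k c)"
    by (intro sum.cong) auto
  finally show ?thesis
    by (simp add: card)
qed

text \<open>
  For \<open>y\<close> outside the set \<open>D\<close> of directions, \<open>x \<mapsto> f x - x * y\<close> is a permutation and the polynomial
  \<open>R y\<close> below is \<open>X ^ q - X\<close>. Its coefficients have small degree in \<open>y\<close>, so most of them vanish for
  all \<open>y\<close>. Hence every \<open>R y\<close> is lacunary, and all power sums of \<open>f x - x * y\<close> below \<open>q - 1\<close> vanish
  even if \<open>y\<close> is a direction.
\<close>
lemma few_directions_sum_eq_0:
  fixes f :: "'a :: {field, finite} \<Rightarrow> 'a"
  assumes dir: "\<And>x z. x \<noteq> z \<Longrightarrow> (f x - f z) / (x - z) \<in> D" and D: "2 * card D < CARD('a)"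
    and j: "1 \<le> j" "j < CARD('a) - 1"
  shows "of_nat j * (\<Sum>x\<in>UNIV. f x * x ^ (j - 1)) = 0"
proof -
  define R where "R y = (\<Prod>x\<in>UNIV. [:- (f x - x * y), 1:])" for y
  have "(f 0 - f 1) / (0 - 1) \<in> D"
    by (rule dir) simp
  then have D1: "1 \<le> card D"
    by (metis One_nat_def Suc_leI card_gt_0_iff empty_iff finite_code)
  have cardD: "card (- D) = CARD('a) - card D"
    by (simp add: Compl_eq_Diff_UNIV card_Diff_subset)
  have inj: "inj (\<lambda>x. f x - x * y)" if "y \<notin> D" for y
  proof (rule injI, rule ccontr)
    fix x z
    assume eq: "f x - x * y = f z - z * y" and "x \<noteq> z"
    then have "(f x - f z) / (x - z) = y"
      by (simp add: field_simps)
    with dir[OF \<open>x \<noteq> z\<close>] that show False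
      by simp
  qed
  have R_inj: "R y = (\<Prod>c\<in>UNIV. [:- c, 1:])" if "inj (\<lambda>x. f x - x * y)" for y
    unfolding R_def
    using that by (intro prod.reindex_bij_betw[of "\<lambda>x. f x - x * y" UNIV UNIV "\<lambda>c. [:- c, 1:]"])
      (simp add: bij_betw_def finite_UNIV_inj_surj)
  have coeff_R: "coeff (R y) i = 0" if i: "card D < i" "2 \<le> i" "i < CARD('a)" for i y
  proof -
    obtain P where P: "\<And>y. coeff (R y) i = poly P y" "P \<noteq> 0 \<longrightarrow> degree P + i \<le> CARD('a)"
      using coeff_prod_linear_degree[of UNIV f "\<lambda>x. x" i] unfolding R_def by auto
    have "P = 0"
    proof (rule ccontr)
      assume "P \<noteq> 0"
      \<comment> \<open>\<open>P\<close> vanishes off \<open>D\<close>, at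
        \<open>CARD('a) - card D\<close> points, but its degree is at most
        \<open>CARD('a) - i\<close>, which is smaller. The bound \<open>2 \<le> i\<close> avoids the
        coefficient of \<open>X\<close> in \<open>X ^ q - X\<close>.\<close>
      have "card (- D) \<le> card {y. poly P y = 0}"
      proof (intro card_mono subsetI)
        fix y assume "y \<in> - D"
        then have "coeff (R y) i = 0"
          using i R_inj[OF inj[of y]] unfolding prod_linear_UNIV
          by (simp add: coeff_pCons split: nat.split)
        then show "y \<in> {y. poly P y = 0}"
          using P(1) by simp
      qed simp
      also have "\<dots> \<le> degree P"
        using \<open>P \<noteq> 0\<close> by (rule card_poly_roots_bound)
      finally show False
        using P(2) \<open>P \<noteq> 0\<close> i cardD D by simp
    qed
    then show ?thesis
      using P(1) by simp
  qed
  have power_sum: "(\<Sum>x\<in>UNIV. (f x - x * y) ^ j) = 0" for y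
  proof (cases "inj (\<lambda>x. f x - x * y)")
    case True
    have "(\<Sum>x\<in>UNIV. (f x - x * y) ^ j) = (\<Sum>c\<in>UNIV. c ^ j)"
      using True by (intro sum.reindex_bij_betw[of "\<lambda>x. f x - x * y" UNIV UNIV "\<lambda>c. c ^ j"])
        (simp add: bij_betw_def finite_UNIV_inj_surj)
    then show ?thesis
      using sum_power_eq_0[OF j] by simp
  next
    case False
    then obtain x z where xz: "x \<noteq> z" "f x - x * y = f z - z * y"
      by (auto simp: inj_def)
    define g where "g = R y - monom 1 CARD('a)"
    have R: "R y = monom 1 CARD('a) + g"
      by (simp add: g_def)
    have "degree g \<le> card D"
    proof (rule degree_le, intro allI impI)
      fix i assume "card D < i"
      moreover have "coeff (R y) CARD('a) = 1"
        using prod_linear_degree(2)[of "\<lambda>x. f x - x * y" UNIV] by (simp add: R_def)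
      moreover have "coeff (R y) i = 0" if "i > CARD('a)"
        using prod_linear_degree(1)[of "\<lambda>x. f x - x * y" UNIV] that
        by (intro coeff_eq_0) (simp add: R_def)
      ultimately show "coeff g i = 0"
        using coeff_R[of i y] D1 by (cases i "CARD('a)" rule: linorder_cases) (auto simp: g_def)
    qed
    then have "g = - [:0, 1:] \<or> pderiv g = 0"
      using D D1 R unfolding R_def by (intro fully_reducible_lacunary[of "\<lambda>x. f x - x * y" g "card D"]) auto
    moreover have pderiv_R: "pderiv (R y) = pderiv g"
      unfolding R by (simp add: pderiv_add pderiv_monom of_nat_card_UNIV)
    \<comment> \<open>With \<open>g = - X\<close> the polynomial \<open>R y\<close> would be
      \<open>X ^ q - X\<close>, whose derivative is -1, whereas the collision of \<open>x\<close>
      and \<open>z\<close> is a double root.\<close>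
    moreover have "g \<noteq> - [:0, 1:]"
    proof
      assume "g = - [:0, 1:]"
      then have "poly (pderiv (R y)) (f x - x * y) \<noteq> 0"
        by (simp add: pderiv_R pderiv_minus pderiv_pCons)
      moreover have factor: "R y = [:- (f x - x * y), 1:] * ([:- (f z - z * y), 1:] *
          (\<Prod>x\<in>UNIV - {x} - {z}. [:- (f x - x * y), 1:]))"
        unfolding R_def
        using xz(1) by (subst prod.remove[of _ x]; simp only: finite_class.finite_UNIV UNIV_I)
          (subst prod.remove[of _ z]; simp)
      have double: "poly (pderiv (p * (r * Q))) c = 0"
        if "poly p c = 0" "poly r c = 0" for p r Q :: "'a poly" and c
        using that by (simp add: pderiv_mult)
      have "poly (pderiv (R y)) (f x - x * y) = 0"
        unfolding factor by (rule double) (use xz(2) in simp_all)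
      ultimately show False
        by contradiction
    qed
    ultimately have "pderiv (R y) = 0"
      by simp
    then show ?thesis
      unfolding R_def by (rule sum_eq_0_if_pderiv_eq_0[of _ "\<lambda>c. c ^ j"])
  qed
  \<comment> \<open>The power sums as a polynomial in \<open>y\<close>: it vanishes everywhere and
    has degree at most \<open>j\<close>, below q. Its coefficient of degree \<open>j - 1\<close> is
    the required expression up to sign.\<close>
  define P where "P = (\<Sum>x\<in>UNIV. [:f x, - x:] ^ j)"
  have "P = 0"
  proof (rule poly_eqI_degree[of UNIV])
    show "poly P y = poly 0 y" for y
      using power_sum[of y] by (simp add: P_def poly_sum poly_power mult.commute)
    have "degree P \<le> j"
      unfolding P_def
    proof (rule degree_sum_le)
      show "degree ([:f x, - x:] ^ j) \<le> j" for x
        using degree_power_le[of "[:f x, - x:]" j] by (simp split: if_splits)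
    qed simp
    then show "degree P < CARD('a)"
      using j by simp
  qed simp
  then have "0 = coeff P (j - 1)"
    by simp
  also have "\<dots> = (\<Sum>x\<in>UNIV. of_nat j * (- x) ^ (j - 1) * f x)"
    using j(1) binomial_symmetric[of "j - 1" j]
    by (simp add: P_def coeff_sum coeff_linear_poly_power)
  also have "\<dots> = (\<Sum>x\<in>UNIV. (- 1) ^ (j - 1) * (of_nat j * (f x * x ^ (j - 1))))"
    by (intro sum.cong refl) (subst power_minus, simp add: mult_ac)
  also have "\<dots> = (- 1) ^ (j - 1) * (of_nat j * (\<Sum>x\<in>UNIV. f x * x ^ (j - 1)))"
    by (simp only: sum_distrib_left)
  finally show ?thesis
    by simp
qed

section \<open>Nonzero squares\<close>

lemma nonzero_squares_iff: "x \<in> nonzero_squares \<longleftrightarrow> x \<noteq> 0 \<and> (\<exists>y. x = y ^ 2)"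
  by (auto simp: nonzero_squares_def)

lemma zero_notin_nonzero_squares [simp]: "0 \<notin> nonzero_squares"
  by (simp add: nonzero_squares_iff)

lemma one_in_nonzero_squares [simp]: "1 \<in> nonzero_squares"
  by (auto simp: nonzero_squares_iff intro!: exI[of _ 1])

lemma power2_in_nonzero_squares_iff [simp]: "x ^ 2 \<in> nonzero_squares \<longleftrightarrow> x \<noteq> 0"
  by (auto simp: nonzero_squares_iff)

lemma mult_in_nonzero_squares: "x \<in> nonzero_squares \<Longrightarrow> y \<in> nonzero_squares \<Longrightarrow> x * y \<in> nonzero_squares"
  unfolding nonzero_squares_iff by (metis no_zero_divisors power_mult_distrib)

lemma inverse_in_nonzero_squares: "x \<in> nonzero_squares \<Longrightarrow> inverse x \<in> nonzero_squares"
  unfolding nonzero_squares_iff by (metis inverse_nonzero_iff_nonzero power_inverse)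

lemma divide_in_nonzero_squares: "x \<in> nonzero_squares \<Longrightarrow> y \<in> nonzero_squares \<Longrightarrow> x / y \<in> nonzero_squares"
  by (simp add: divide_inverse mult_in_nonzero_squares inverse_in_nonzero_squares)

lemma power_in_nonzero_squares: "x \<in> nonzero_squares \<Longrightarrow> x ^ n \<in> nonzero_squares"
  by (induction n) (simp_all add: mult_in_nonzero_squares)

lemma mult_in_nonzero_squares_iff:
  assumes "x \<in> nonzero_squares"
  shows "x * y \<in> nonzero_squares \<longleftrightarrow> y \<in> nonzero_squares"
proof
  assume "x * y \<in> nonzero_squares"
  then have "x * y / x \<in> nonzero_squares"
    using assms by (rule divide_in_nonzero_squares)
  moreover have "x \<noteq> 0"
    using assms by auto
  ultimately show "y \<in> nonzero_squares"
    by simp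
qed (use assms in \<open>rule mult_in_nonzero_squares\<close>)

lemma card_nonzero_squares:
  assumes "(2 :: 'a :: {field, finite}) \<noteq> 0"
  shows "Suc (2 * card (nonzero_squares :: 'a set)) = CARD('a)"
proof -
  have fiber: "card {x \<in> UNIV - {0 :: 'a}. x ^ 2 = s} = 2" if s: "s \<in> nonzero_squares" for s
  proof -
    obtain y where y: "s = y ^ 2" "y \<noteq> 0"
      using s by (auto simp: nonzero_squares_iff)
    have "y \<noteq> - y"
    proof
      assume "y = - y"
      then have "2 * y = 0"
        by (metis add.right_inverse mult_2)
      with assms y(2) show False
        by simp
    qed
    moreover have "{x \<in> UNIV - {0}. x ^ 2 = s} = {y, - y}"
      using y by (auto simp: power2_eq_iff)
    ultimately show ?thesis
      by simp
  qed
  have "card (UNIV - {0 :: 'a}) = (\<Sum>x\<in>UNIV - {0 :: 'a}. 1)"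
    by simp
  also have "\<dots> = (\<Sum>s\<in>(nonzero_squares :: 'a set). \<Sum>x\<in>{x \<in> UNIV - {0}. x ^ 2 = s}. 1)"
    by (rule sum.group[symmetric]) auto
  also have "\<dots> = (\<Sum>s\<in>(nonzero_squares :: 'a set). 2)"
    by (intro sum.cong refl) (use fiber in simp)
  finally have "CARD('a) - 1 = 2 * card (nonzero_squares :: 'a set)"
    by (simp add: card_Diff_singleton)
  then show ?thesis
    using card_UNIV_ge_2[where 'a = 'a] by simp
qed

definition nonsquares :: "'a :: field set" where
  "nonsquares = - insert 0 nonzero_squares"

lemma nonsquares_iff: "x \<in> nonsquares \<longleftrightarrow> x \<noteq> 0 \<and> x \<notin> nonzero_squares"
  by (simp add: nonsquares_def)

lemma card_nonsquares:
  assumes "(2 :: 'a :: {field, finite}) \<noteq> 0"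
  shows "card (nonsquares :: 'a set) = card (nonzero_squares :: 'a set)"
proof -
  have "card (nonsquares :: 'a set) = CARD('a) - card (insert 0 nonzero_squares :: 'a set)"
    unfolding nonsquares_def by (simp only: Compl_eq_Diff_UNIV card_Diff_subset finite_class.finite top_greatest)
  also have "card (insert 0 nonzero_squares :: 'a set) = Suc (card (nonzero_squares :: 'a set))"
    by simp
  finally show ?thesis
    using card_nonzero_squares[OF assms] by simp
qed

lemma square_times_nonsquare:
  assumes "x \<in> nonzero_squares" "y \<in> nonsquares"
  shows "x * y \<in> nonsquares"
  using assms by (auto simp: nonsquares_iff mult_in_nonzero_squares_iff)

text \<open>Multiplication by a nonsquare sends the squares injectively into the nonsquares; both
  sets have the same size, so every nonsquare is hit.\<close>

lemma nonsquare_times_nonsquare: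
  fixes x y :: "'a :: {field, finite}"
  assumes "(2 :: 'a) \<noteq> 0" "x \<in> nonsquares" "y \<in> nonsquares"
  shows "x * y \<in> nonzero_squares"
proof -
  have x0: "x \<noteq> 0"
    using assms(2) by (simp add: nonsquares_iff)
  have "(\<lambda>s. x * s) ` nonzero_squares = nonsquares"
  proof (rule card_subset_eq)
    show "(\<lambda>s. x * s) ` nonzero_squares \<subseteq> nonsquares"
      using square_times_nonsquare[OF _ assms(2)] by (auto simp: mult.commute)
    show "card ((\<lambda>s. x * s) ` nonzero_squares) = card (nonsquares :: 'a set)"
      using x0 by (simp add: card_nonsquares assms(1) card_image inj_on_def)
  qed simp
  with assms(3) obtain s where s: "s \<in> nonzero_squares" "y = x * s"
    by blast
  then have "x * y = s * x ^ 2"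
    by (simp add: power2_eq_square mult_ac)
  with s(1) x0 show ?thesis
    by (simp add: mult_in_nonzero_squares)
qed

lemma square_mult_nonsquare_iff:
  assumes "(2 :: 'a :: {field, finite}) \<noteq> 0" "x \<in> nonsquares"
  shows "x * y \<in> nonzero_squares \<longleftrightarrow> y \<in> (nonsquares :: 'a set)"
  using assms square_times_nonsquare[of y x] nonsquare_times_nonsquare[of x y]
  by (cases "y = 0") (auto simp: nonsquares_iff mult.commute)

text \<open>The values are integers, not field elements, so that sums can be bounded by
  size.\<close>

definition quad_char :: "'a :: field \<Rightarrow> int" where
  "quad_char x = (if x = 0 then 0 else if x \<in> nonzero_squares then 1 else - 1)"

lemma quad_char_mult:
  assumes "(2 :: 'a :: {field, finite}) \<noteq> 0"
  shows "quad_char (x * y) = quad_char x * quad_char (y :: 'a)"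
proof (cases "x = 0 \<or> y = 0")
  case False
  then show ?thesis
    using mult_in_nonzero_squares_iff[of x y] square_mult_nonsquare_iff[OF assms, of x y]
    by (auto simp: quad_char_def nonsquares_iff)
qed (auto simp: quad_char_def)

lemma sum_quad_char:
  assumes "(2 :: 'a :: {field, finite}) \<noteq> 0"
  shows "(\<Sum>x\<in>UNIV. quad_char (x :: 'a)) = 0"
proof -
  have "(\<Sum>x\<in>UNIV. quad_char (x :: 'a)) = (\<Sum>x\<in>nonzero_squares \<union> nonsquares. quad_char (x :: 'a))"
    by (rule sum.mono_neutral_right) (auto simp: quad_char_def nonsquares_iff)
  also have "\<dots> = (\<Sum>x\<in>nonzero_squares. quad_char (x :: 'a)) + (\<Sum>x\<in>nonsquares. quad_char (x :: 'a))"
    by (rule sum.union_disjoint) (auto simp: nonsquares_iff)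
  also have "(\<Sum>x\<in>nonzero_squares. quad_char (x :: 'a)) = (\<Sum>x\<in>(nonzero_squares :: 'a set). 1)"
    by (intro sum.cong) (auto simp: quad_char_def)
  also have "(\<Sum>x\<in>nonsquares. quad_char (x :: 'a)) = (\<Sum>x\<in>(nonsquares :: 'a set). - 1)"
    by (intro sum.cong) (auto simp: quad_char_def nonsquares_iff)
  finally show ?thesis
    by (simp add: card_nonsquares[OF assms])
qed

text \<open>The substitution \<open>t = (x - a) / (y - a)\<close> turns the summand into the
  character of \<open>t\<close>, as the character of \<open>y - a\<close> squares to 1. It omits
  exactly the value \<open>t = 1\<close>, so -1 remains of a sum that is zero over the whole
  field.\<close>

lemma sum_quad_char_shift_mult:
  fixes x y :: "'a :: {field, finite}"
  assumes two: "(2 :: 'a) \<noteq> 0" and "x \<noteq> y"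
  shows "(\<Sum>a\<in>UNIV. quad_char (x - a) * quad_char (y - a)) = - 1"
proof -
  have "(\<Sum>a\<in>UNIV. quad_char (x - a) * quad_char (y - a)) =
      (\<Sum>a\<in>UNIV - {y}. quad_char (x - a) * quad_char (y - a))"
    by (rule sum.mono_neutral_right) (auto simp: quad_char_def)
  also have "\<dots> = (\<Sum>t\<in>UNIV - {1 :: 'a}. quad_char t)"
  proof (rule sum.reindex_bij_witness[of _ "\<lambda>t. (x - t * y) / (1 - t)" "\<lambda>a. (x - a) / (y - a)"])
    fix a
    assume a: "a \<in> UNIV - {y}"
    then have "quad_char (x - a) = quad_char ((x - a) / (y - a)) * quad_char (y - a)"
      by (simp flip: quad_char_mult[OF two])
    moreover have "quad_char (y - a) * quad_char (y - a) = 1"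
      using a by (simp add: quad_char_def)
    ultimately show "quad_char ((x - a) / (y - a)) = quad_char (x - a) * quad_char (y - a)"
      by simp
    show "(x - (x - a) / (y - a) * y) / (1 - (x - a) / (y - a)) = a"
    proof -
      have "x - (x - a) / (y - a) * y = a * (y - x) / (y - a)" "1 - (x - a) / (y - a) = (y - x) / (y - a)"
        using a by (simp_all add: field_simps)
      with a assms(2) show ?thesis
        by simp
    qed
    show "(x - a) / (y - a) \<in> UNIV - {1}"
      using a assms(2) by simp
  next
    fix t
    assume t: "t \<in> UNIV - {1 :: 'a}"
    then have "x - (x - t * y) / (1 - t) = t * (y - x) / (1 - t)"
      "y - (x - t * y) / (1 - t) = (y - x) / (1 - t)"
      by (simp_all add: field_simps)
    with t assms(2) show "(x - (x - t * y) / (1 - t)) / (y - (x - t * y) / (1 - t)) = t"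
      by simp
    show "(x - t * y) / (1 - t) \<in> UNIV - {y}"
      using t assms(2) by (auto simp: field_simps)
  qed
  also have "\<dots> = - 1"
    by (simp add: sum_diff1 sum_quad_char[OF two]) (simp add: quad_char_def)
  finally show ?thesis .
qed

text \<open>
  By the preceding lemma the quadratic characters of \<open>x - a\<close> and \<open>z - a\<close>, as functions of \<open>a\<close>, are
  nearly uncorrelated, so they cannot agree on half of the field.
\<close>
lemma eq_if_same_square_differences:
  fixes x z :: "'a :: {field, finite}"
  assumes two: "(2 :: 'a) \<noteq> 0"
    and T: "\<And>a. a \<in> T \<Longrightarrow> x \<noteq> a \<and> z \<noteq> a \<and> (x - a \<in> nonzero_squares \<longleftrightarrow> z - a \<in> nonzero_squares)"
    and card: "CARD('a) \<le> 2 * card T"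
  shows "x = z"
proof (rule ccontr)
  assume "x \<noteq> z"
  let ?g = "\<lambda>a. quad_char (x - a) * quad_char (z - a)"
  \<comment> \<open>The total is at least \<open>card T - card (- T)\<close>, which is not negative,
    so it cannot be -1.\<close>
  have "(\<Sum>a\<in>T. ?g a) = (\<Sum>a\<in>T. 1)"
    by (intro sum.cong refl) (use T in \<open>auto simp: quad_char_def\<close>)
  moreover have "(\<Sum>a\<in>- T. ?g a) \<ge> (\<Sum>a\<in>- T. - 1)"
    by (intro sum_mono) (auto simp: quad_char_def)
  moreover have "(\<Sum>a\<in>UNIV. ?g a) = (\<Sum>a\<in>T. ?g a) + (\<Sum>a\<in>- T. ?g a)"
    by (subst sum.union_disjoint[symmetric]) auto
  moreover have "card (- T) = CARD('a) - card T" "card T \<le> CARD('a)"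
    by (simp_all add: Compl_eq_Diff_UNIV card_Diff_subset card_mono)
  ultimately show False
    using sum_quad_char_shift_mult[OF two \<open>x \<noteq> z\<close>] card by simp
qed

section \<open>Preservers of 2 by 2 positive definiteness are bijective\<close>

lemma idempotent_funpow:
  fixes f :: "'a :: finite \<Rightarrow> 'a"
  obtains n where "1 \<le> n" "\<And>x. (f ^^ n) ((f ^^ n) x) = (f ^^ n) x"
proof -
  have "\<not> inj (\<lambda>n. f ^^ n)"
    using finite_imageD[of "\<lambda>n. f ^^ n" UNIV] by auto
  then obtain i j where ij: "i < j" "f ^^ i = f ^^ j"
    by (metis injI linorder_neqE_nat)
  define d where "d = j - i"
  have step: "f ^^ (m + d) = f ^^ m" if "i \<le> m" for m
  proof -
    have "f ^^ (m + d) = f ^^ (m - i) \<circ> f ^^ j"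
      using ij(1) that by (simp add: d_def flip: funpow_add)
    also have "\<dots> = f ^^ m"
      using that by (simp add: ij(2)[symmetric] flip: funpow_add)
    finally show ?thesis .
  qed
  have steps: "f ^^ (m + k * d) = f ^^ m" if "i \<le> m" for m k
  proof (induction k)
    case (Suc k)
    have "f ^^ (m + Suc k * d) = f ^^ ((m + k * d) + d)"
      by (simp add: algebra_simps)
    then show ?case
      using step[of "m + k * d"] Suc that by simp
  qed simp
  have "d \<ge> 1"
    using ij(1) by (simp add: d_def)
  then have "i \<le> Suc i * d"
    by (metis Suc_leD mult.right_neutral mult_le_mono2)
  \<comment> \<open>The factor \<open>Suc i\<close> yields a multiple of the period \<open>d\<close>
    beyond the preperiod \<open>i\<close> that is positive even if \<open>i = 0\<close>.\<close>
  show ?thesis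
  proof (rule that[of "Suc i * d"])
    show "1 \<le> Suc i * d"
      using \<open>d \<ge> 1\<close> by simp
    show "(f ^^ (Suc i * d)) ((f ^^ (Suc i * d)) x) = (f ^^ (Suc i * d)) x" for x
      using steps[OF \<open>i \<le> Suc i * d\<close>, of "Suc i"] by (metis comp_apply funpow_add)
  qed
qed

text \<open>
  Preservation of positive definiteness of the matrices with rows \<open>(a, b)\<close> and \<open>(b, c)\<close>.
\<close>
definition preserves_pd2 :: "('a :: field \<Rightarrow> 'a) \<Rightarrow> bool" where
  "preserves_pd2 f \<longleftrightarrow> (\<forall>a b c. a \<in> nonzero_squares \<and> a * c - b ^ 2 \<in> nonzero_squares \<longrightarrow>
     f a \<in> nonzero_squares \<and> f a * f c - f b ^ 2 \<in> nonzero_squares)"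

lemma preserves_pd2D:
  assumes "preserves_pd2 f" "a \<in> nonzero_squares"
  shows "a * c - b ^ 2 \<in> nonzero_squares \<Longrightarrow> f a * f c - f b ^ 2 \<in> nonzero_squares"
    and "f a \<in> nonzero_squares"
proof -
  have "a * a - 0 ^ 2 \<in> nonzero_squares"
    using mult_in_nonzero_squares[OF assms(2,2)] by simp
  then show "f a \<in> nonzero_squares"
    using assms unfolding preserves_pd2_def by blast
  show "a * c - b ^ 2 \<in> nonzero_squares \<Longrightarrow> f a * f c - f b ^ 2 \<in> nonzero_squares"
    using assms unfolding preserves_pd2_def by blast
qed

lemma preserves_pd2_comp: "preserves_pd2 f \<Longrightarrow> preserves_pd2 g \<Longrightarrow> preserves_pd2 (\<lambda>x. f (g x))"
  unfolding preserves_pd2_def by blast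

lemma preserves_pd2_funpow: "preserves_pd2 f \<Longrightarrow> preserves_pd2 (f ^^ n)"
proof (induction n)
  case 0
  then show ?case
    by (simp add: preserves_pd2_def)
next
  case (Suc n)
  then show ?case
    using preserves_pd2_comp[of f "f ^^ n"] by (simp add: comp_def)
qed

text \<open>The matrix with rows \<open>(u, u)\<close> and \<open>(u, c)\<close> has determinant
  \<open>u * (c - u)\<close>; the square factors \<open>u\<close> and \<open>f u\<close>
  cancel.\<close>

lemma preserves_pd2_diff:
  assumes "preserves_pd2 f" "u \<in> nonzero_squares" "c - u \<in> nonzero_squares"
  shows "f c - f u \<in> nonzero_squares"
proof -
  have "u * c - u ^ 2 \<in> nonzero_squares"
    using mult_in_nonzero_squares[OF assms(2,3)] by (simp add: algebra_simps power2_eq_square)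
  then have "f u * f c - f u ^ 2 \<in> nonzero_squares"
    using preserves_pd2D assms(1,2) by blast
  then have "f u * (f c - f u) \<in> nonzero_squares"
    by (simp add: algebra_simps power2_eq_square)
  then show ?thesis
    using mult_in_nonzero_squares_iff[OF preserves_pd2D(2)[OF assms(1,2)]] by simp
qed

lemma preserves_pd2_mult_diff:
  assumes "preserves_pd2 f" "a \<in> nonzero_squares" "x * (a - x) \<in> nonzero_squares"
  shows "f x * (f a - f x) \<in> nonzero_squares"
proof -
  have "a * x - x ^ 2 \<in> nonzero_squares"
    using assms(3) by (simp add: algebra_simps power2_eq_square)
  then have "f a * f x - f x ^ 2 \<in> nonzero_squares"
    using preserves_pd2D assms(1,2) by blast
  then show ?thesis
    by (simp add: algebra_simps power2_eq_square)
qed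

text \<open>Adjoining 0 gives (q + 1) / 2 elements, just enough test points for
  \<open>eq_if_same_square_differences\<close>.\<close>

lemma half_le_card_insert:
  assumes "(2 :: 'a :: {field, finite}) \<noteq> 0"
  shows "CARD('a) \<le> 2 * card (insert 0 nonzero_squares :: 'a set)"
    "CARD('a) \<le> 2 * card (insert 0 nonsquares :: 'a set)"
  using card_nonzero_squares[OF assms] card_nonsquares[OF assms] by (simp_all add: nonsquares_iff)

text \<open>
  If \<open>- 1\<close> is a square, the matrices with \<open>(a, b, c) = (a, a, x)\<close> and \<open>(a, x, x)\<close> show that \<open>e\<close>
  preserves and reflects whether \<open>x - a\<close> is a square for a square \<open>a\<close> and a nonsquare \<open>x\<close>. As \<open>e x\<close>
  is fixed by \<open>e\<close>, it has the same square differences as \<open>x\<close>.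
\<close>
lemma idempotent_eq_id_if_minus_1_square:
  fixes e :: "'a :: {field, finite} \<Rightarrow> 'a"
  assumes two: "(2 :: 'a) \<noteq> 0" and minus1: "- 1 \<in> (nonzero_squares :: 'a set)"
    and e: "preserves_pd2 e" and idem: "\<And>x. e (e x) = e x"
  shows "e x = x"
proof -
  let ?S = "nonzero_squares :: 'a set" and ?N = "nonsquares :: 'a set"
  note e_S = preserves_pd2D(2)[OF e]
  have neg_S: "- x \<in> ?S \<longleftrightarrow> x \<in> ?S" for x
    using mult_in_nonzero_squares_iff[OF minus1, of x] by simp
  have swap_S: "x - y \<in> ?S \<longleftrightarrow> y - x \<in> ?S" for x y
    using neg_S[of "x - y"] by simp
  have swap_N: "x - y \<in> ?N \<longleftrightarrow> y - x \<in> ?N" for x y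
    using swap_S[of x y] by (auto simp: nonsquares_iff)
  note NN = square_mult_nonsquare_iff[OF two]
  have P0: "e a * e 0 - e b ^ 2 \<in> ?S" if "a \<in> ?S" "b \<noteq> 0" for a b
    using preserves_pd2D(1)[OF e that(1), of 0 b] that(2) neg_S[of "b ^ 2"] by simp
  have e_0: "e 0 = 0"
  proof (rule ccontr)
    assume d: "e 0 \<noteq> 0"
    show False
    proof (cases "e 0 \<in> ?S")
      case True
      then show False
        using P0[OF True d] by (simp add: idem power2_eq_square)
    next
      case False
      then have N: "e 0 \<in> ?N"
        using d by (simp add: nonsquares_iff)
      have "e 0 * (e 1 - e 0) \<in> ?S"
        using P0[of 1 "e 0"] d by (simp add: idem power2_eq_square algebra_simps)
      then have "e 1 - e 0 \<in> ?N"
        using NN[OF N] by simp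
      moreover have "e 1 * (e 0 - e 1) \<in> ?S"
        using P0[of 1 1] by (simp add: power2_eq_square algebra_simps)
      then have "e 0 - e 1 \<in> ?S"
        using mult_in_nonzero_squares_iff[OF e_S[OF one_in_nonzero_squares]] by simp
      ultimately show False
        using swap_S by (auto simp: nonsquares_iff)
    qed
  qed
  have e_N: "e x \<in> ?N" if x: "x \<in> ?N" for x
  proof -
    have "x \<noteq> 0"
      using x by (simp add: nonsquares_iff)
    then have "e x \<noteq> 0"
      using P0[of 1 x] by (auto simp: e_0)
    \<comment> \<open>If \<open>e x\<close> were a square, it would be a fixed point in the squares.
      One of \<open>x - e x\<close> and \<open>x * (e x - x)\<close> is a square, and either way its
      counterpart after applying \<open>e\<close> is 0.\<close>
    moreover have "e x \<notin> ?S"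
    proof
      assume z: "e x \<in> ?S"
      then have "x - e x \<notin> ?S"
        using preserves_pd2_diff[OF e z, of x] by (auto simp: idem)
      moreover have "x \<noteq> e x"
        using x z by (auto simp: nonsquares_iff)
      ultimately have "e x - x \<in> ?N"
        using swap_S[of x "e x"] by (simp add: nonsquares_iff)
      then have "x * (e x - x) \<in> ?S"
        using NN[OF x] by simp
      then have "e x * (e (e x) - e x) \<in> ?S"
        by (rule preserves_pd2_mult_diff[OF e z])
      then show False
        by (simp add: idem)
    qed
    ultimately show ?thesis
      by (simp add: nonsquares_iff)
  qed
  have exact: "x - a \<in> ?S \<longleftrightarrow> e x - e a \<in> ?S" if a: "a \<in> ?S" and x: "x \<in> ?N" for a x
  proof
    show "x - a \<in> ?S \<Longrightarrow> e x - e a \<in> ?S"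
      by (rule preserves_pd2_diff[OF e a])
    assume *: "e x - e a \<in> ?S"
    show "x - a \<in> ?S"
    proof (rule ccontr)
      assume "x - a \<notin> ?S"
      moreover have "x \<noteq> a"
        using a x by (auto simp: nonsquares_iff)
      ultimately have "a - x \<in> ?N"
        using swap_S[of a x] by (simp add: nonsquares_iff)
      then have "e x * (e a - e x) \<in> ?S"
        using preserves_pd2_mult_diff[OF e a] NN[OF x] by simp
      then have "e a - e x \<in> ?N"
        using NN[OF e_N[OF x]] by simp
      then show False
        using * swap_S[of "e a" "e x"] by (simp add: nonsquares_iff)
    qed
  qed
  have fix_N: "e x = x" if x: "x \<in> ?N" for x
  proof (rule eq_if_same_square_differences[OF two _ half_le_card_insert(1)[OF two]])
    fix a
    assume "a \<in> insert 0 ?S"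
    then show "e x \<noteq> a \<and> x \<noteq> a \<and> (e x - a \<in> ?S \<longleftrightarrow> x - a \<in> ?S)"
      using exact[OF _ x, of a] exact[OF _ e_N[OF x], of a] x e_N[OF x]
      by (auto simp: nonsquares_iff idem)
  qed
  \<comment> \<open>The nonsquares, now known to be fixed, serve as test points for the
    squares.\<close>
  have fix_S: "e s = s" if s: "s \<in> ?S" for s
  proof (rule eq_if_same_square_differences[OF two _ half_le_card_insert(2)[OF two]])
    fix a
    assume "a \<in> insert 0 ?N"
    then show "e s \<noteq> a \<and> s \<noteq> a \<and> (e s - a \<in> ?S \<longleftrightarrow> s - a \<in> ?S)"
      using exact[OF s, of a] s e_S[OF s] fix_N[of a] swap_S[of a s] swap_S[of a "e s"]
      by (auto simp: nonsquares_iff)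
  qed
  show ?thesis
    using fix_N[of x] fix_S[of x] e_0 by (cases "x = 0"; cases "x \<in> ?S") (auto simp: nonsquares_iff)
qed

text \<open>
  If \<open>- 1\<close> is not a square, exactly one of \<open>a - b\<close> and \<open>b - a\<close> is a square, so \<open>e\<close> is injective on
  the squares. For a nonsquare \<open>x\<close>, scaling by \<open>e x / x\<close> shows that the inclusion of the sets of
  squares at square distance from \<open>x\<close> and from \<open>e x\<close> is an equality.
\<close>
lemma idempotent_eq_id_if_minus_1_nonsquare:
  fixes e :: "'a :: {field, finite} \<Rightarrow> 'a"
  assumes two: "(2 :: 'a) \<noteq> 0" and minus1: "- 1 \<notin> (nonzero_squares :: 'a set)"
    and e: "preserves_pd2 e" and idem: "\<And>x. e (e x) = e x"
  shows "e x = x"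
proof -
  let ?S = "nonzero_squares :: 'a set" and ?N = "nonsquares :: 'a set"
  note e_S = preserves_pd2D(2)[OF e]
  have neg_S: "- x \<in> ?S \<longleftrightarrow> x \<in> ?N" for x
    using square_mult_nonsquare_iff[OF two, of "- 1" x] minus1 by (simp add: nonsquares_iff)
  have swap_S: "x - y \<in> ?S \<longleftrightarrow> y - x \<in> ?N" for x y
    using neg_S[of "y - x"] by simp
  have fix_S: "e a = a" if a: "a \<in> ?S" for a
  proof (rule ccontr)
    assume "e a \<noteq> a"
    \<comment> \<open>Whichever difference is a square, \<open>e\<close> maps both elements to
      \<open>e a\<close>, and the difference of the images is 0.\<close>
    then consider "e a - a \<in> ?S" | "a - e a \<in> ?S"
      using swap_S[of "e a" a] by (auto simp: nonsquares_iff)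
    then show False
      using preserves_pd2_diff[OF e a, of "e a"] preserves_pd2_diff[OF e e_S[OF a], of a]
      by cases (simp_all add: idem)
  qed
  have e_0: "e 0 = 0"
  proof (rule ccontr)
    assume d: "e 0 \<noteq> 0"
    have *: "a * a - e 0 ^ 2 \<in> ?S" if "a \<in> ?S" for a
      using preserves_pd2D(1)[OF e that, of a 0] that by (simp add: fix_S mult_in_nonzero_squares)
    have "e 0 \<in> ?S \<or> - e 0 \<in> ?S"
      using d neg_S by (auto simp: nonsquares_iff)
    then show False
      using *[of "e 0"] *[of "- e 0"] by (auto simp: power2_eq_square)
  qed
  have fix_N: "e x = x" if x: "x \<in> ?N" for x
  proof -
    have sub: "e x - a \<in> ?S" if "a \<in> ?S" "x - a \<in> ?S" for a
      using preserves_pd2_diff[OF e that] by (simp add: fix_S that(1))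
    \<comment> \<open>Otherwise the elements \<open>x - a\<close> with \<open>a\<close> a square
      would be exactly the nonsquares, so one of them would be \<open>x\<close>, with
      \<open>a = 0\<close>.\<close>
    have "\<exists>a\<in>?S. x - a \<in> ?S"
    proof (rule ccontr)
      assume *: "\<not> ?thesis"
      have "(\<lambda>a. x - a) ` ?S = ?N"
      proof (rule card_subset_eq)
        show "(\<lambda>a. x - a) ` ?S \<subseteq> ?N"
          using * x by (auto simp: nonsquares_iff)
        show "card ((\<lambda>a. x - a) ` ?S) = card ?N"
          by (simp add: card_nonsquares two card_image inj_on_def)
      qed simp
      then have "x \<in> (\<lambda>a. x - a) ` ?S"
        using x by simp
      then show False
        by auto
    qed
    then obtain a where a: "a \<in> ?S" "x - a \<in> ?S"
      by blast
    have "e x \<noteq> 0"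
      using sub[OF a] a(1) neg_S[of a] by (auto simp: nonsquares_iff)
    moreover have "e x \<notin> ?S"
    proof
      assume z: "e x \<in> ?S"
      have "a - x \<in> ?N"
        using a(2) swap_S by simp
      then have "x * (a - x) \<in> ?S"
        using square_mult_nonsquare_iff[OF two x] by simp
      then have "e x * (a - e x) \<in> ?S"
        using preserves_pd2_mult_diff[OF e a(1)] fix_S[OF a(1)] by metis
      then have "a - e x \<in> ?S"
        using mult_in_nonzero_squares_iff[OF z] by simp
      then show False
        using sub[OF a] swap_S[of "e x" a] by (simp add: nonsquares_iff)
    qed
    ultimately have z: "e x \<in> ?N"
      by (simp add: nonsquares_iff)
    have x0: "x \<noteq> 0"
      using x by (simp add: nonsquares_iff)
    define r where "r = e x / x"
    have r: "r \<in> ?S" "e x = r * x" "r \<noteq> 0"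
    proof -
      have "r = (x * e x) / x ^ 2"
        using x0 by (simp add: r_def power2_eq_square)
      then show "r \<in> ?S"
        using nonsquare_times_nonsquare[OF two x z] x0 by (simp add: divide_in_nonzero_squares)
      then show "r \<noteq> 0"
        by auto
      show "e x = r * x"
        using x0 by (simp add: r_def)
    qed
    have "{a \<in> ?S. x - a \<in> ?S} = {a \<in> ?S. e x - a \<in> ?S}"
    proof (rule card_seteq)
      show "{a \<in> ?S. x - a \<in> ?S} \<subseteq> {a \<in> ?S. e x - a \<in> ?S}"
        using sub by blast
      have "b \<in> (\<lambda>a. r * a) ` {a \<in> ?S. x - a \<in> ?S}" if b: "b \<in> ?S" "e x - b \<in> ?S" for b
      proof -
        have "x - b / r = (e x - b) / r"
          using r(2,3) by (simp add: diff_divide_distrib)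
        then have "b / r \<in> {a \<in> ?S. x - a \<in> ?S}"
          using divide_in_nonzero_squares[OF _ r(1)] b by (metis (mono_tags, lifting) mem_Collect_eq)
        moreover have "b = r * (b / r)"
          using r(3) by simp
        ultimately show ?thesis
          by (rule rev_image_eqI)
      qed
      then show "card {a \<in> ?S. e x - a \<in> ?S} \<le> card {a \<in> ?S. x - a \<in> ?S}"
        by (intro surj_card_le[of _ _ "\<lambda>a. r * a"]) auto
    qed simp
    then have same: "x - a \<in> ?S \<longleftrightarrow> e x - a \<in> ?S" if "a \<in> ?S" for a
      using that by blast
    show "e x = x"
    proof (rule eq_if_same_square_differences[OF two _ half_le_card_insert(1)[OF two]])
      fix a
      assume "a \<in> insert 0 ?S"
      then show "e x \<noteq> a \<and> x \<noteq> a \<and> (e x - a \<in> ?S \<longleftrightarrow> x - a \<in> ?S)"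
        using same[of a] x z by (auto simp: nonsquares_iff)
    qed
  qed
  show ?thesis
    using fix_N[of x] fix_S[of x] e_0 by (cases "x = 0"; cases "x \<in> ?S") (auto simp: nonsquares_iff)
qed

lemma preserves_pd2_imp_bij:
  fixes f :: "'a :: {field, finite} \<Rightarrow> 'a"
  assumes two: "(2 :: 'a) \<noteq> 0" and f: "preserves_pd2 f"
  shows "bij f"
proof -
  obtain n where n: "1 \<le> n" "\<And>x. (f ^^ n) ((f ^^ n) x) = (f ^^ n) x"
    using idempotent_funpow[of f] by blast
  have id: "(f ^^ n) x = x" for x
    using idempotent_eq_id_if_minus_1_square[OF two _ preserves_pd2_funpow[OF f] n(2)]
      idempotent_eq_id_if_minus_1_nonsquare[OF two _ preserves_pd2_funpow[OF f] n(2)] by blast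
  have "inj f"
  proof (rule injI)
    fix x y
    assume "f x = f y"
    then have "(f ^^ Suc (n - 1)) x = (f ^^ Suc (n - 1)) y"
      by (simp add: funpow_Suc_right del: funpow.simps)
    with n(1) show "x = y"
      by (simp add: id)
  qed
  then show ?thesis
    by (simp add: bij_def finite_UNIV_inj_surj)
qed

section \<open>Bijective preservers in odd characteristic\<close>

text \<open>The two translates of the squares have equal size and therefore coincide. Adding up
  their elements gives \<open>x = y\<close>, since the number of squares is invertible in the field:
  twice it is -1 there.\<close>

lemma eq_if_shift_nonzero_squares_subset:
  fixes x y :: "'a :: {field, finite}"
  assumes two: "(2 :: 'a) \<noteq> 0"
    and sub: "\<And>c. c - x \<in> nonzero_squares \<Longrightarrow> c - y \<in> nonzero_squares"
  shows "x = y"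
proof -
  let ?S = "nonzero_squares :: 'a set"
  have "(\<lambda>s. x + s) ` ?S = (\<lambda>s. y + s) ` ?S"
  proof (rule card_subset_eq)
    show "(\<lambda>s. x + s) ` ?S \<subseteq> (\<lambda>s. y + s) ` ?S"
    proof
      fix c
      assume "c \<in> (\<lambda>s. x + s) ` ?S"
      then have "c - y \<in> ?S"
        using sub[of c] by auto
      then show "c \<in> (\<lambda>s. y + s) ` ?S"
        by (intro rev_image_eqI[of "c - y"]) simp_all
    qed
    show "card ((\<lambda>s. x + s) ` ?S) = card ((\<lambda>s. y + s) ` ?S)"
      by (simp add: card_image)
  qed simp
  then have "(\<Sum>c\<in>(\<lambda>s. x + s) ` ?S. c) = (\<Sum>c\<in>(\<lambda>s. y + s) ` ?S. c)"
    by simp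
  then have "(\<Sum>s\<in>?S. x + s) = (\<Sum>s\<in>?S. y + s)"
    by (simp add: sum.reindex)
  then have "of_nat (card ?S) * x = of_nat (card ?S) * y"
    by (simp add: sum.distrib)
  moreover have "of_nat (card ?S) \<noteq> (0 :: 'a)"
  proof
    assume "of_nat (card ?S) = (0 :: 'a)"
    then have "of_nat (Suc (2 * card ?S)) = (1 :: 'a)"
      by simp
    then show False
      by (simp only: card_nonzero_squares[OF two] of_nat_card_UNIV) simp
  qed
  ultimately show ?thesis
    by simp
qed

lemma divide_in_nonzero_squares_if_same_class:
  fixes x y :: "'a :: {field, finite}"
  assumes two: "(2 :: 'a) \<noteq> 0" and "x \<noteq> 0" "y \<noteq> 0" "x \<in> nonzero_squares \<longleftrightarrow> y \<in> nonzero_squares"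
  shows "x / y \<in> nonzero_squares"
proof (cases "x \<in> nonzero_squares")
  case True
  then show ?thesis
    using assms by (simp add: divide_in_nonzero_squares)
next
  case False
  then have "x * y \<in> nonzero_squares"
    using assms by (intro nonsquare_times_nonsquare) (auto simp: nonsquares_iff)
  then have "x * y / y ^ 2 \<in> nonzero_squares"
    using assms(3) by (simp add: divide_in_nonzero_squares)
  then show ?thesis
    using assms(3) by (simp add: power2_eq_square)
qed

text \<open>
  The matrices with \<open>a * c - b ^ 2\<close> a square say that \<open>f\<close> maps \<open>b ^ 2 / a + S\<close> into \<open>f b ^ 2 / f a + S\<close>,
  where \<open>S\<close> is the set of nonzero squares. But \<open>f\<close> also maps \<open>u + S\<close> onto \<open>f u + S\<close> for \<open>u\<close> in \<open>S\<close>, whence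
  \<open>f (b ^ 2 / a) = f b ^ 2 / f a\<close>.
\<close>
lemma bij_preserves_pd2_imp_multiplicative:
  fixes f :: "'a :: {field, finite} \<Rightarrow> 'a"
  assumes two: "(2 :: 'a) \<noteq> 0" and f: "preserves_pd2 f" and bij: "bij f" and f_1: "f 1 = 1"
  shows "f 0 = 0" "f (x * y) = f x * f y"
    and "x \<noteq> y \<Longrightarrow> (f x - f y) / (x - y) \<in> nonzero_squares"
proof -
  let ?S = "nonzero_squares :: 'a set" and ?N = "nonsquares :: 'a set"
  note f_S = preserves_pd2D(2)[OF f]
  have inj: "inj f"
    using bij by (rule bij_is_inj)
  have img_S: "f ` ?S = ?S"
    using f_S inj by (intro endo_inj_surj) (auto intro: inj_on_subset)
  have f_S_iff: "f x \<in> ?S \<longleftrightarrow> x \<in> ?S" for x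
    using img_S inj_image_mem_iff[OF inj, of x ?S] by simp
  show f_0: "f 0 = 0"
  proof (rule ccontr)
    assume "f 0 \<noteq> 0"
    \<comment> \<open>The choice of \<open>a\<close> gives the diagonal matrix with entries
      \<open>a\<close> and 1 an image of determinant 0.\<close>
    then have "f 0 ^ 2 \<in> f ` ?S"
      using img_S by simp
    then obtain a where a: "a \<in> ?S" "f a = f 0 ^ 2"
      by auto
    then have "f a * f 1 - f 0 ^ 2 \<in> ?S"
      by (intro preserves_pd2D(1)[OF f]) simp_all
    then show False
      by (simp add: a(2) f_1)
  qed
  have f_eq_0: "f x = 0 \<longleftrightarrow> x = 0" for x
    using f_0 inj by (metis injD)
  have f_N: "f x \<in> ?N \<longleftrightarrow> x \<in> ?N" for x
    using f_S_iff[of x] f_eq_0[of x] by (simp add: nonsquares_iff)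
  have exact: "f c - f u \<in> ?S \<longleftrightarrow> c - u \<in> ?S" if u: "u \<in> ?S" for c u
  proof
    show "c - u \<in> ?S \<Longrightarrow> f c - f u \<in> ?S"
      by (rule preserves_pd2_diff[OF f u])
    have "f ` (\<lambda>s. u + s) ` ?S = (\<lambda>s. f u + s) ` ?S"
    proof (rule card_subset_eq)
      show "f ` (\<lambda>s. u + s) ` ?S \<subseteq> (\<lambda>s. f u + s) ` ?S"
      proof
        fix d
        assume "d \<in> f ` (\<lambda>s. u + s) ` ?S"
        then obtain s where s: "s \<in> ?S" "d = f (u + s)"
          by auto
        then have "d - f u \<in> ?S"
          using preserves_pd2_diff[OF f u, of "u + s"] by simp
        then show "d \<in> (\<lambda>s. f u + s) ` ?S"
          by (intro rev_image_eqI[of "d - f u"]) simp_all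
      qed
      show "card (f ` (\<lambda>s. u + s) ` ?S) = card ((\<lambda>s. f u + s) ` ?S)"
        using inj by (simp add: card_image inj_on_subset)
    qed simp
    moreover assume "f c - f u \<in> ?S"
    then have "f c \<in> (\<lambda>s. f u + s) ` ?S"
      by (intro rev_image_eqI[of "f c - f u"]) simp_all
    ultimately have "f c \<in> f ` (\<lambda>s. u + s) ` ?S"
      by simp
    then have "c \<in> (\<lambda>s. u + s) ` ?S"
      using inj_image_mem_iff[OF inj] by blast
    then show "c - u \<in> ?S"
      by auto
  qed
  have square_div: "f (b ^ 2 / a) = f b ^ 2 / f a" if a: "a \<in> ?S" and b: "b \<noteq> 0" for a b
  proof (rule eq_if_shift_nonzero_squares_subset[OF two])
    fix c'
    assume *: "c' - f (b ^ 2 / a) \<in> ?S"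
    obtain c where c: "c' = f c"
      using bij by (metis bij_pointE)
    have a0: "a \<noteq> 0" "f a \<noteq> 0"
      using a f_S[OF a] by auto
    have "b ^ 2 / a \<in> ?S"
      using a b by (simp add: divide_in_nonzero_squares)
    then have "c - b ^ 2 / a \<in> ?S"
      using * exact c by simp
    then have "a * (c - b ^ 2 / a) \<in> ?S"
      using a by (simp add: mult_in_nonzero_squares)
    then have "a * c - b ^ 2 \<in> ?S"
      using a0 by (simp add: right_diff_distrib)
    then have "f a * f c - f b ^ 2 \<in> ?S"
      by (rule preserves_pd2D(1)[OF f a])
    then have "(f a * f c - f b ^ 2) / f a \<in> ?S"
      using f_S[OF a] by (simp add: divide_in_nonzero_squares)
    then show "c' - f b ^ 2 / f a \<in> ?S"
      using a0 c by (simp add: diff_divide_distrib)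
  qed
  have square: "f (b ^ 2) = f b ^ 2" for b
    using square_div[of 1 b] by (cases "b = 0") (simp_all add: f_1 f_0)
  have div_S: "f (s / a) = f s / f a" if sa: "s \<in> ?S" "a \<in> ?S" for s a
  proof -
    obtain b where "s = b ^ 2" "b \<noteq> 0"
      using sa(1) by (auto simp: nonzero_squares_iff)
    then show ?thesis
      using square_div[OF sa(2)] square by simp
  qed
  have mult_SS: "f (s * a) = f s * f a" if sa: "s \<in> ?S" "a \<in> ?S" for s a
    using div_S[of s "1 / a"] div_S[of 1 a] sa by (simp add: f_1 divide_in_nonzero_squares)
  \<comment> \<open>Both sides are nonsquares. Division by \<open>a\<close> and by
    \<open>f a\<close> moves the factor to the test point, \<open>s / a\<close> against
    \<open>f s / f a\<close>, where \<open>exact\<close> and \<open>div_S\<close> apply.\<close>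
  have mult_SN: "f (a * c) = f a * f c" if a: "a \<in> ?S" and c: "c \<in> ?N" for a c
  proof (rule eq_if_same_square_differences[OF two _ half_le_card_insert(1)[OF two]])
    fix t
    assume t: "t \<in> insert 0 ?S"
    have N: "f (a * c) \<in> ?N" "f a * f c \<in> ?N"
      using a c f_N f_S square_times_nonsquare by auto
    have "f (a * c) - t \<in> ?S \<longleftrightarrow> f a * f c - t \<in> ?S" if "t \<in> ?S"
    proof -
      obtain s where s: "s \<in> ?S" "t = f s"
        using \<open>t \<in> ?S\<close> img_S by auto
      have a0: "a \<noteq> 0" "f a \<noteq> 0"
        using a f_S[OF a] by auto
      have "f (a * c) - f s \<in> ?S \<longleftrightarrow> a * c - s \<in> ?S"
        using s(1) by (rule exact)
      also have "\<dots> \<longleftrightarrow> c - s / a \<in> ?S"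
        using mult_in_nonzero_squares_iff[OF a, of "c - s / a"] a0 by (simp add: right_diff_distrib)
      also have "\<dots> \<longleftrightarrow> f c - f s / f a \<in> ?S"
        using exact[of "s / a" c] div_S[OF s(1) a] s(1) a by (simp add: divide_in_nonzero_squares)
      also have "\<dots> \<longleftrightarrow> f a * f c - f s \<in> ?S"
        using mult_in_nonzero_squares_iff[OF f_S[OF a], of "f c - f s / f a"] a0
        by (simp add: right_diff_distrib)
      finally show ?thesis
        by (simp only: s(2))
    qed
    with t N show "f (a * c) \<noteq> t \<and> f a * f c \<noteq> t \<and> (f (a * c) - t \<in> ?S \<longleftrightarrow> f a * f c - t \<in> ?S)"
      by (auto simp: nonsquares_iff)
  qed
  have mult_NN: "f (c * d) = f c * f d" if c: "c \<in> ?N" and d: "d \<in> ?N" for c d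
  proof -
    have c0: "c \<noteq> 0"
      using c by (simp add: nonsquares_iff)
    have w: "d / c \<in> ?S"
      using c d by (intro divide_in_nonzero_squares_if_same_class[OF two]) (auto simp: nonsquares_iff)
    have "f (c * d) = f (d / c * c ^ 2)"
      using c0 by (simp add: power2_eq_square mult.commute)
    also have "\<dots> = f (d / c) * f c ^ 2"
      using c0 by (subst mult_SS[OF w]) (simp_all add: square)
    also have "\<dots> = f (d / c) * f c * f c"
      by (simp add: power2_eq_square)
    also have "f (d / c) * f c = f (d / c * c)"
      using mult_SN[OF w c] by simp
    finally show ?thesis
      using c0 by simp
  qed
  have mult: "f (x * y) = f x * f y" for x y
  proof (cases "x = 0 \<or> y = 0")
    case True
    then show ?thesis
      by (auto simp: f_0)
  next
    case False
    then consider "x \<in> ?S" "y \<in> ?S" | "x \<in> ?S" "y \<in> ?N" | "x \<in> ?N" "y \<in> ?S" | "x \<in> ?N" "y \<in> ?N"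
      by (auto simp: nonsquares_iff)
    then show ?thesis
      by cases (use mult_SS mult_SN[of x y] mult_SN[of y x] mult_NN in \<open>simp_all add: mult.commute\<close>)
  qed
  then show "f (x * y) = f x * f y" .
  show "(f x - f y) / (x - y) \<in> ?S" if "x \<noteq> y"
  proof (cases "y = 0")
    case True
    with that show ?thesis
      by (auto simp: f_0 f_eq_0 f_S_iff intro!: divide_in_nonzero_squares_if_same_class[OF two])
  next
    case False
    have "f y \<noteq> 0"
      using False f_eq_0 by simp
    \<comment> \<open>As \<open>exact\<close> covers only squares \<open>u\<close>, multiplicativity
      moves the slope to the base point 1.\<close>
    have "f x = f y * f (x / y)"
      using mult[of y "x / y"] False by simp
    then have "f x - f y = f y * (f (x / y) - f 1)" "x - y = y * (x / y - 1)"
      using False by (simp_all add: f_1 right_diff_distrib)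
    then have "(f x - f y) / (x - y) = (f y / y) * ((f (x / y) - f 1) / (x / y - 1))"
      by (simp only: times_divide_times_eq)
    moreover have "f y / y \<in> ?S"
      using False \<open>f y \<noteq> 0\<close> f_S_iff by (intro divide_in_nonzero_squares_if_same_class[OF two]) auto
    moreover have "(f (x / y) - f 1) / (x / y - 1) \<in> ?S"
    proof (rule divide_in_nonzero_squares_if_same_class[OF two])
      show "x / y - 1 \<noteq> 0"
        using that False by simp
      then show "f (x / y) - f 1 \<noteq> 0"
        using injD[OF inj, of "x / y" 1] by auto
    qed (simp add: exact)
    ultimately show ?thesis
      by (metis mult_in_nonzero_squares)
  qed
qed

lemma odd_power_in_nonzero_squares_iff:
  assumes "odd n" "x \<noteq> 0"
  shows "x ^ n \<in> nonzero_squares \<longleftrightarrow> x \<in> nonzero_squares"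
proof -
  obtain i where n: "n = Suc (2 * i)"
    using assms(1) oddE by fastforce
  have "x ^ n = (x ^ i) ^ 2 * x"
    by (simp add: n power_mult[symmetric] mult.commute)
  moreover have "(x ^ i) ^ 2 \<in> nonzero_squares"
    using assms(2) by simp
  ultimately show ?thesis
    using mult_in_nonzero_squares_iff by metis
qed

lemma two_neq_0_if_odd_CHAR:
  assumes "prime p" "CHAR('a :: field) = p" "odd p"
  shows "(2 :: 'a) \<noteq> 0"
proof
  assume "(2 :: 'a) = 0"
  then have "p dvd 2"
    using of_nat_eq_0_iff_char_dvd[of 2, where 'a = 'a] assms(2) by simp
  then have "p = 2"
    using assms(1) by (simp add: primes_dvd_imp_eq)
  with assms(3) show False
    by simp
qed

text \<open>
  Removing the factor of \<open>d\<close> that is a power of \<open>p\<close> does not change the assumption. If \<open>s > 1\<close> remains,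
  the expression in \<open>few_directions_sum_eq_0\<close> for \<open>x ^ s\<close> and \<open>j = q - s\<close> is
  \<open>- s * (\<Sum>x. x ^ (q - 1)) = s\<close>, which is not zero.
\<close>
lemma power_directions_squares_imp_prime_power:
  fixes d :: nat
  assumes p: "prime p" "CHAR('a :: {field, finite}) = p" "odd p"
    and d: "1 \<le> d" "d \<le> CARD('a) - 1"
    and dir: "\<And>x y :: 'a. x \<noteq> y \<Longrightarrow> (x ^ d - y ^ d) / (x - y) \<in> nonzero_squares"
  shows "\<exists>t. d = p ^ t"
proof -
  have two: "(2 :: 'a) \<noteq> 0"
    by (rule two_neq_0_if_odd_CHAR[OF p])
  have "d \<noteq> 0" "\<not> is_unit p"
    using d(1) p(1) by auto
  then obtain s where s: "d = p ^ multiplicity p d * s" "\<not> p dvd s"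
    by (rule multiplicity_decompose')
  define t where "t = multiplicity p d"
  define P where "P = p ^ t"
  have d_eq: "d = s * P"
    using s(1) by (simp add: P_def t_def mult.commute)
  have "odd P"
    using p(3) by (simp add: P_def)
  have frob: "(x - y) ^ P = x ^ P - y ^ P" for x y :: 'a
    using freshmans_dream'[of P t "x - y" y] p(1,2) by (simp add: P_def algebra_simps)
  \<comment> \<open>\<open>P\<close> is odd, so a nonzero element is a square exactly if its
    \<open>P\<close>-th power is; hence \<open>x ^ s - y ^ s\<close> lies in the same class as
    \<open>x ^ d - y ^ d\<close>.\<close>
  have dir_s: "(x ^ s - y ^ s) / (x - y) \<in> nonzero_squares" if "x \<noteq> y" for x y :: 'a
  proof -
    have "x ^ d - y ^ d = (x ^ s - y ^ s) ^ P"
      by (simp add: frob d_eq power_mult)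
    moreover have "(x ^ d - y ^ d) / (x - y) \<in> nonzero_squares"
      using that by (rule dir)
    ultimately have *: "(x ^ s - y ^ s) ^ P / (x - y) \<in> nonzero_squares"
      by simp
    have ne: "x ^ s - y ^ s \<noteq> 0"
    proof
      assume "x ^ s - y ^ s = 0"
      with * odd_pos[OF \<open>odd P\<close>] show False
        by (simp add: power_0_left)
    qed
    have "(x ^ s - y ^ s) ^ P \<in> nonzero_squares \<longleftrightarrow> x - y \<in> nonzero_squares"
    proof -
      have "(x ^ s - y ^ s) ^ P = (x ^ s - y ^ s) ^ P / (x - y) * (x - y)"
        using that by simp
      then show ?thesis
        using mult_in_nonzero_squares_iff[OF *, of "x - y"] by simp
    qed
    then show ?thesis
      using ne that \<open>odd P\<close>
      by (intro divide_in_nonzero_squares_if_same_class[OF two]) (simp_all add: odd_power_in_nonzero_squares_iff)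
  qed
  have "1 \<le> s"
    using d(1) d_eq by (cases s) auto
  have "s \<le> d"
    using d(1) d_eq by simp
  have "s = 1"
  proof (rule ccontr)
    assume "s \<noteq> 1"
    define j where "j = CARD('a) - s"
    have j: "1 \<le> j" "j < CARD('a) - 1" "s + (j - 1) = CARD('a) - 1"
      using \<open>1 \<le> s\<close> \<open>s \<noteq> 1\<close> \<open>s \<le> d\<close> d(2) card_UNIV_ge_2[where 'a = 'a] by (simp_all add: j_def)
    \<comment> \<open>There are (q - 1) / 2 squares, so \<open>D\<close> is small enough;
      \<open>s > 1\<close> enters through \<open>j < CARD('a) - 1\<close>.\<close>
    have "of_nat j * (\<Sum>x\<in>UNIV. x ^ s * x ^ (j - 1)) = (0 :: 'a)"
      using card_nonzero_squares[OF two] j dir_s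
      by (intro few_directions_sum_eq_0[where D = nonzero_squares]) auto
    then have "of_nat j = (0 :: 'a)"
      unfolding power_add[symmetric] j(3) sum_power_card_minus_1 by simp
    moreover have "of_nat j + of_nat s = (of_nat CARD('a) :: 'a)"
      using \<open>s \<le> d\<close> d(2) by (simp add: j_def flip: of_nat_add)
    ultimately have "of_nat s = (0 :: 'a)"
      by (simp add: of_nat_card_UNIV)
    then show False
      using s(2) p(2) of_nat_eq_0_iff_char_dvd by blast
  qed
  then show ?thesis
    by (auto simp: d_eq P_def)
qed

section \<open>Positive definite matrices of small size\<close>

lemma det_mat_2:
  "det (mat 2 2 g) = g (0, 0) * g (1, 1) - g (0, 1) * (g (1, 0) :: 'a :: comm_ring_1)"
proof -
  have "det (mat 2 2 g) = (\<Sum>j<2. mat 2 2 g $$ (0, j) * cofactor (mat 2 2 g) 0 j)"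
    by (rule laplace_expansion_row) auto
  then show ?thesis
    by (simp add: numeral_2_eq_2 cofactor_def mat_delete_def det_single)
qed

lemma det_mat_3:
  "det (mat 3 3 g) =
    g (0, 0) * (g (1, 1) * g (2, 2) - g (1, 2) * g (2, 1))
    - g (0, 1) * (g (1, 0) * g (2, 2) - g (1, 2) * g (2, 0))
    + g (0, 2) * (g (1, 0) * g (2, 1) - g (1, 1) * (g (2, 0) :: 'a :: comm_ring_1))"
proof -
  have cof: "cofactor (mat 3 3 g) 0 j = (- 1) ^ j *
      det (mat 2 2 (\<lambda>(i, i'). g (Suc i, if i' < j then i' else Suc i')))" if "j < 3" for j
  proof -
    have "mat_delete (mat 3 3 g) 0 j = mat 2 2 (\<lambda>(i, i'). g (Suc i, if i' < j then i' else Suc i'))"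
      by (rule eq_matI) (auto simp: mat_delete_def)
    then show ?thesis
      by (simp add: cofactor_def)
  qed
  have "det (mat 3 3 g) = (\<Sum>j<3. mat 3 3 g $$ (0, j) * cofactor (mat 3 3 g) 0 j)"
    by (rule laplace_expansion_row) auto
  also have "\<dots> = g (0, 0) * cofactor (mat 3 3 g) 0 0 + g (0, 1) * cofactor (mat 3 3 g) 0 1
      + g (0, 2) * cofactor (mat 3 3 g) 0 2"
    by (simp add: lessThan_nat_numeral)
  finally have det: "det (mat 3 3 g) = \<dots>" .
  have lt: "(0 :: nat) < 3" "(1 :: nat) < 3" "(2 :: nat) < 3"
    by simp_all
  show ?thesis
    unfolding det lt[THEN cof] det_mat_2
    by (simp add: numeral_2_eq_2 algebra_simps)
qed

lemma leading_principal_minor_eq: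
  assumes "A \<in> carrier_mat n n" "r \<le> n"
  shows "leading_principal_minor A r = det (mat r r (\<lambda>(i, j). A $$ (i, j)))"
  by (simp add: leading_principal_minor_def submatrix_lessThan[OF assms])

text \<open>The zeros in the border of \<open>B\<close> are mapped to \<open>f 0\<close>, which
  might be nonzero, so \<open>map_mat f B\<close> need not be a block diagonal matrix. Its leading
  minors of order at most \<open>m\<close>, however, are those of
  \<open>map_mat f A\<close>.\<close>

lemma preserves_positive_definiteness_mono:
  fixes f :: "'a :: field \<Rightarrow> 'a"
  assumes f: "preserves_positive_definiteness n f" and m: "1 \<le> m" "m \<le> n"
  shows "preserves_positive_definiteness m f"
  unfolding preserves_positive_definiteness_def
proof (intro allI impI)
  fix A :: "'a mat"
  assume A: "positive_definite m A"
  then have cA: "A \<in> carrier_mat m m" and sym: "A\<^sup>T = A"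
    and minors: "\<And>r. r \<in> {1..m} \<Longrightarrow> leading_principal_minor A r \<in> nonzero_squares"
    by (auto simp: positive_definite_def)
  have sym': "A $$ (i, j) = A $$ (j, i)" if "i < m" "j < m" for i j
    using arg_cong[OF sym, of "\<lambda>M. M $$ (i, j)"] that cA by simp
  define B where "B = mat n n (\<lambda>(i, j). if i < m \<and> j < m then A $$ (i, j) else if i = j then 1 else 0)"
  have cB: "B \<in> carrier_mat n n"
    by (simp add: B_def)
  have "positive_definite n B"
    unfolding positive_definite_def
  proof (intro conjI ballI)
    show "B\<^sup>T = B"
      by (rule eq_matI) (auto simp: B_def sym')
    fix r
    assume r: "r \<in> {1..n}"
    have "leading_principal_minor B r = leading_principal_minor A (min r m)"
    proof (cases "r \<le> m")
      case True
      then have "mat r r (\<lambda>(i, j). B $$ (i, j)) = mat r r (\<lambda>(i, j). A $$ (i, j))"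
        using m by (intro eq_matI) (auto simp: B_def)
      then show ?thesis
        using True m r by (simp add: leading_principal_minor_eq[OF cA] leading_principal_minor_eq[OF cB] min_absorb1)
    next
      case False
      have A_eq: "mat m m (($$) A) = A"
        using cA by (intro eq_matI) auto
      have "mat r r (\<lambda>(i, j). B $$ (i, j)) =
          four_block_mat A (0\<^sub>m m (r - m)) (0\<^sub>m (r - m) m) (1\<^sub>m (r - m))"
        using cA False r by (intro eq_matI) (auto simp: B_def)
      also have "det \<dots> = det A * det (1\<^sub>m (r - m) :: 'a mat)"
        using cA by (intro det_four_block_mat_upper_right_zero) auto
      finally show ?thesis
        using False r by (simp add: leading_principal_minor_eq[OF cA] leading_principal_minor_eq[OF cB] A_eq min_absorb2)
    qed
    then show "leading_principal_minor B r \<in> nonzero_squares"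
      using minors[of "min r m"] r m by simp
  qed (rule cB)
  then have fB: "positive_definite n (map_mat f B)"
    using f by (simp add: preserves_positive_definiteness_def)
  have cfB: "map_mat f B \<in> carrier_mat n n" and cfA: "map_mat f A \<in> carrier_mat m m"
    using cA cB by auto
  show "positive_definite m (map_mat f A)"
    unfolding positive_definite_def
  proof (intro conjI ballI)
    show "(map_mat f A)\<^sup>T = map_mat f A"
      using cA by (intro eq_matI) (auto simp: sym')
    fix r
    assume r: "r \<in> {1..m}"
    then have "mat r r (\<lambda>(i, j). map_mat f A $$ (i, j)) = mat r r (\<lambda>(i, j). map_mat f B $$ (i, j))"
      using cA m by (intro eq_matI) (auto simp: B_def)
    then have "leading_principal_minor (map_mat f A) r = leading_principal_minor (map_mat f B) r"
      using r m by (simp add: leading_principal_minor_eq[OF cfA] leading_principal_minor_eq[OF cfB])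
    then show "leading_principal_minor (map_mat f A) r \<in> nonzero_squares"
      using fB r m by (simp add: positive_definite_def)
  qed (rule cfA)
qed

lemma positive_definite_1_iff:
  "positive_definite 1 A \<longleftrightarrow> A \<in> carrier_mat 1 1 \<and> A $$ (0, 0) \<in> nonzero_squares"
proof -
  have "A\<^sup>T = A \<and> leading_principal_minor A 1 = A $$ (0, 0)" if A: "A \<in> carrier_mat 1 1"
  proof -
    have "A\<^sup>T = A"
      using A by (intro eq_matI) auto
    then show ?thesis
      using A by (simp add: leading_principal_minor_eq[OF A] det_single)
  qed
  then show ?thesis
    by (auto simp: positive_definite_def)
qed

lemma preserves_positive_definiteness_1_iff:
  "preserves_positive_definiteness 1 f \<longleftrightarrow> f ` nonzero_squares \<subseteq> nonzero_squares"
proof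
  assume f: "preserves_positive_definiteness 1 f"
  show "f ` nonzero_squares \<subseteq> nonzero_squares"
  proof (rule image_subsetI)
    fix x :: 'a
    assume "x \<in> nonzero_squares"
    then have "positive_definite 1 (mat 1 1 (\<lambda>_. x))"
      unfolding positive_definite_1_iff by simp
    then have "positive_definite 1 (map_mat f (mat 1 1 (\<lambda>_. x)))"
      using f by (simp add: preserves_positive_definiteness_def)
    then show "f x \<in> nonzero_squares"
      unfolding positive_definite_1_iff by simp
  qed
next
  assume "f ` nonzero_squares \<subseteq> nonzero_squares"
  then show "preserves_positive_definiteness 1 f"
    unfolding preserves_positive_definiteness_def positive_definite_1_iff by auto
qed

lemma positive_definite_2_iff:
  "positive_definite 2 A \<longleftrightarrow> A \<in> carrier_mat 2 2 \<and> A $$ (0, 1) = A $$ (1, 0) \<and>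
    A $$ (0, 0) \<in> nonzero_squares \<and> A $$ (0, 0) * A $$ (1, 1) - A $$ (0, 1) ^ 2 \<in> nonzero_squares"
proof (cases "A \<in> carrier_mat 2 2")
  case True
  have "{1..2 :: nat} = {1, 2}"
    by auto
  moreover have "leading_principal_minor A 1 = A $$ (0, 0)"
    using leading_principal_minor_eq[OF True, of 1] by (simp add: det_single)
  moreover have "leading_principal_minor A 2 = A $$ (0, 0) * A $$ (1, 1) - A $$ (0, 1) * A $$ (1, 0)"
    using leading_principal_minor_eq[OF True, of 2] by (simp add: det_mat_2)
  moreover have "A\<^sup>T = A \<longleftrightarrow> A $$ (0, 1) = A $$ (1, 0)"
  proof
    assume "A\<^sup>T = A"
    from arg_cong[OF this, of "\<lambda>M. M $$ (0, 1)"] show "A $$ (0, 1) = A $$ (1, 0)"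
      using True by simp
  next
    assume *: "A $$ (0, 1) = A $$ (1, 0)"
    show "A\<^sup>T = A"
    proof (rule eq_matI)
      fix i j
      assume "i < dim_row A" "j < dim_col A"
      then have "i = 0 \<or> i = 1" "j = 0 \<or> j = 1"
        using True by auto
      then show "A\<^sup>T $$ (i, j) = A $$ (i, j)"
        using True * by auto
    qed (use True in simp_all)
  qed
  ultimately show ?thesis
    using True by (auto simp: positive_definite_def power2_eq_square)
next
  case False
  then show ?thesis
    by (simp add: positive_definite_def)
qed

lemma preserves_positive_definiteness_2_iff:
  "preserves_positive_definiteness 2 f \<longleftrightarrow> preserves_pd2 f"
proof
  assume f: "preserves_positive_definiteness 2 f"
  show "preserves_pd2 f"
    unfolding preserves_pd2_def
  proof (intro allI impI)
    fix a b c :: 'a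
    assume *: "a \<in> nonzero_squares \<and> a * c - b ^ 2 \<in> nonzero_squares"
    define A where "A = mat 2 2 (\<lambda>(i, j). if i \<noteq> j then b else if i = 0 then a else c)"
    have "positive_definite 2 A"
      using * unfolding positive_definite_2_iff by (simp add: A_def)
    then have "positive_definite 2 (map_mat f A)"
      using f by (simp add: preserves_positive_definiteness_def)
    then show "f a \<in> nonzero_squares \<and> f a * f c - f b ^ 2 \<in> nonzero_squares"
      unfolding positive_definite_2_iff by (simp add: A_def)
  qed
next
  assume f: "preserves_pd2 f"
  show "preserves_positive_definiteness 2 f"
    unfolding preserves_positive_definiteness_def positive_definite_2_iff
    using f by (auto simp: preserves_pd2_def)
qed

text \<open>A Frobenius power is a ring homomorphism and commutes with determinants, so the minor of
  order \<open>r\<close> becomes \<open>c ^ r\<close> times a power of the old one.\<close>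

lemma preserves_positive_definiteness_frobenius:
  fixes c :: "'a :: {field, finite}"
  assumes p: "prime p" "CHAR('a) = p" and c: "c \<in> nonzero_squares" and f: "\<And>x. f x = c * x ^ p ^ j"
  shows "preserves_positive_definiteness n f"
  unfolding preserves_positive_definiteness_def
proof (intro allI impI)
  fix A :: "'a mat"
  assume "positive_definite n A"
  then have cA: "A \<in> carrier_mat n n" and sym: "A\<^sup>T = A"
    and minors: "\<And>r. r \<in> {1..n} \<Longrightarrow> leading_principal_minor A r \<in> nonzero_squares"
    by (auto simp: positive_definite_def)
  interpret frob: comm_ring_hom "\<lambda>x :: 'a. x ^ p ^ j"
    by unfold_locales
      (use p prime_gt_0_nat[of p] in \<open>simp_all add: power_mult_distrib freshmans_dream' power_0_left\<close>)
  have cfA: "map_mat f A \<in> carrier_mat n n"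
    using cA by simp
  show "positive_definite n (map_mat f A)"
    unfolding positive_definite_def
  proof (intro conjI ballI)
    show "(map_mat f A)\<^sup>T = map_mat f A"
      by (metis map_mat_transpose sym)
    fix r
    assume r: "r \<in> {1..n}"
    let ?M = "mat r r (\<lambda>(i, j). A $$ (i, j))"
    have "mat r r (\<lambda>(i, j). map_mat f A $$ (i, j)) = c \<cdot>\<^sub>m map_mat (\<lambda>x. x ^ p ^ j) ?M"
      using cA r by (intro eq_matI) (auto simp: f)
    then have "leading_principal_minor (map_mat f A) r = c ^ r * (leading_principal_minor A r) ^ p ^ j"
      using r by (simp add: leading_principal_minor_eq[OF cfA] leading_principal_minor_eq[OF cA])
    then show "leading_principal_minor (map_mat f A) r \<in> nonzero_squares"
      using minors[OF r] c by (simp add: mult_in_nonzero_squares power_in_nonzero_squares)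
  qed (rule cfA)
qed

section \<open>Characteristic two\<close>

lemma even_power2_eq_iff:
  fixes x y :: "'a :: field"
  assumes "(2 :: 'a) = 0"
  shows "x ^ 2 = y ^ 2 \<longleftrightarrow> x = y"
proof -
  have "- y = y"
    using assms by (metis add_eq_0_iff mult_2 mult_zero_left)
  then show ?thesis
    by (metis power2_eq_iff)
qed

lemma even_ex_sqrt:
  fixes x :: "'a :: {field, finite}"
  assumes "(2 :: 'a) = 0"
  shows "\<exists>y. x = y ^ 2"
proof -
  have "inj (\<lambda>x :: 'a. x ^ 2)"
    using even_power2_eq_iff[OF assms] by (intro injI) blast
  then have "surj (\<lambda>x :: 'a. x ^ 2)"
    by (simp add: finite_UNIV_inj_surj)
  then show ?thesis
    by (metis surjE)
qed

lemma even_nonzero_squares: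
  assumes "(2 :: 'a :: {field, finite}) = 0"
  shows "x \<in> nonzero_squares \<longleftrightarrow> (x :: 'a) \<noteq> 0"
  using even_ex_sqrt[OF assms] by (simp add: nonzero_squares_iff)

lemma preserves_pd2_normalize:
  fixes f :: "'a :: field \<Rightarrow> 'a"
  assumes "preserves_pd2 f"
  shows "preserves_pd2 (\<lambda>x. f x / f 1)"
  unfolding preserves_pd2_def
proof (intro allI impI conjI)
  fix a b c :: 'a
  assume *: "a \<in> nonzero_squares \<and> a * c - b ^ 2 \<in> nonzero_squares"
  have f_1: "f 1 \<in> nonzero_squares"
    by (rule preserves_pd2D(2)[OF assms]) simp
  then show "f a / f 1 \<in> nonzero_squares"
    using preserves_pd2D(2)[OF assms] * by (simp add: divide_in_nonzero_squares)
  have "f a / f 1 * (f c / f 1) - (f b / f 1) ^ 2 = (f a * f c - f b ^ 2) / f 1 ^ 2"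
    by (simp add: power_divide diff_divide_distrib power2_eq_square)
  moreover have "(f a * f c - f b ^ 2) / f 1 ^ 2 \<in> nonzero_squares"
    using preserves_pd2D(1)[OF assms] * f_1 by (intro divide_in_nonzero_squares) auto
  ultimately show "f a / f 1 * (f c / f 1) - (f b / f 1) ^ 2 \<in> nonzero_squares"
    by simp
qed

text \<open>Inequality of \<open>a * c\<close> and \<open>b ^ 2\<close> passes from arguments to
  values. Bijectivity reverses this: a square root of \<open>g a * g c\<close> is some value
  \<open>g b'\<close>, and then \<open>a * c = b' ^ 2\<close>.\<close>

lemma even_preserves_pd2_imp_multiplicative:
  fixes g :: "'a :: {field, finite} \<Rightarrow> 'a"
  assumes two: "(2 :: 'a) = 0" and g: "preserves_pd2 g" and g_1: "g 1 = 1"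
  shows "inj g" "g 0 = 0" "g (x * y) = g x * g y"
proof -
  note S = even_nonzero_squares[OF two]
  have nz: "g a \<noteq> 0" if "a \<noteq> 0" for a
    using preserves_pd2D(2)[OF g] that by (simp add: S)
  have P: "g a * g c \<noteq> g b ^ 2" if "a \<noteq> 0" "a * c \<noteq> b ^ 2" for a b c
    using preserves_pd2D(1)[OF g, of a c b] that by (simp add: S)
  note sqrt = even_ex_sqrt[OF two] and sq_inj = even_power2_eq_iff[OF two, THEN iffD1]
  have ne: "g x \<noteq> g y" if "x \<noteq> y" "y \<noteq> 0" for x y
    using P[of y y x] that sq_inj[of x y] by (metis power2_eq_square)
  show inj: "inj g"
    by (rule injI) (metis ne)
  then have surj: "surj g"
    by (simp add: finite_UNIV_inj_surj)
  then show g_0: "g 0 = 0"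
    by (metis nz surjE)
  have key: "g b ^ 2 = g a * g c" if ab: "a \<noteq> 0" "b ^ 2 = a * c" for a b c
  proof -
    obtain b' where b': "g a * g c = g b' ^ 2"
      using sqrt[of "g a * g c"] surj by (metis surjE)
    then have "a * c = b' ^ 2"
      using P[OF ab(1), of c b'] by blast
    then have "b = b'"
      using ab(2) sq_inj by simp
    then show ?thesis
      using b' by simp
  qed
  have square: "g (b ^ 2) = g b ^ 2" for b
    using key[of 1 b "b ^ 2"] by (simp add: g_1)
  show "g (x * y) = g x * g y"
  proof (cases "x = 0")
    case False
    obtain b where b: "x * y = b ^ 2"
      using sqrt by blast
    then show ?thesis
      using key[OF False b[symmetric]] square by simp
  qed (simp add: g_0)
qed

text \<open>Let \<open>e\<close> be the quotient of \<open>n = CARD('a) - 1\<close> by a gcd greater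
  than 1. For nonzero \<open>x\<close> the \<open>d\<close>-th power of \<open>x ^ e\<close> is 1,
  so injectivity gives \<open>x ^ e = 1\<close>. Then the power sums with exponents \<open>e\<close>
  and \<open>n\<close> would agree, but they are 0 and -1.\<close>

lemma inj_power_imp_coprime:
  assumes d: "1 \<le> d" and inj: "inj (\<lambda>x :: 'a :: {field, finite}. x ^ d)"
  shows "gcd d (CARD('a) - 1) = 1"
proof (rule ccontr)
  define n where "n = CARD('a) - 1"
  assume "gcd d (CARD('a) - 1) \<noteq> 1"
  then have r: "gcd d n \<noteq> 1" "gcd d n \<noteq> 0"
    using d by (auto simp: n_def)
  have n: "n \<ge> 1"
    using card_UNIV_ge_2[where 'a = 'a] by (simp add: n_def)
  define e where "e = n div gcd d n"
  have e: "n = e * gcd d n"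
    by (simp add: e_def)
  have "e \<ge> 1"
    using n e by (metis One_nat_def Suc_leI mult_0 not_gr_zero not_one_le_zero)
  moreover have "gcd d n > 1"
    using r by linarith
  ultimately have "e * 1 < e * gcd d n"
    by (intro mult_strict_left_mono) simp_all
  then have "e < n"
    using e by simp
  have "x ^ e = x ^ n" for x :: 'a
  proof (cases "x = 0")
    case False
    have pow_n: "x ^ n = 1"
      using power_card_minus_1[OF False] by (simp add: n_def)
    have "(x ^ e) ^ d = x ^ (e * gcd d n * (d div gcd d n))"
      by (simp add: mult.assoc flip: power_mult)
    also have "\<dots> = 1 ^ d"
      by (simp add: e[symmetric] power_mult pow_n)
    finally show ?thesis
      using injD[OF inj, of "x ^ e" 1] pow_n by simp
  qed (use n \<open>e \<ge> 1\<close> in \<open>simp add: power_0_left\<close>)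
  then have "(\<Sum>x\<in>UNIV. x ^ e) = (\<Sum>x\<in>UNIV. (x :: 'a) ^ n)"
    by simp
  then have "0 = (- 1 :: 'a)"
    using sum_power_eq_0[of e, where 'a = 'a] \<open>e \<ge> 1\<close> \<open>e < n\<close> sum_power_card_minus_1[where 'a = 'a]
    unfolding n_def by simp
  then show False
    by simp
qed

text \<open>Bezout gives an exponent \<open>u\<close> inverting \<open>d\<close> modulo the order of
  the multiplicative group. The bound on \<open>d\<close> matters for the field with two elements,
  where \<open>d = 0\<close> has gcd 1 as well.\<close>

lemma coprime_imp_inj_power:
  assumes d: "1 \<le> d" and "gcd d (CARD('a :: {field, finite}) - 1) = 1"
  shows "inj (\<lambda>x :: 'a. x ^ d)"
proof -
  obtain u v where uv: "d * u = (CARD('a) - 1) * v + 1"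
    using bezout_nat[of d "CARD('a) - 1"] assms by auto
  have "(x ^ d) ^ u = x" for x :: 'a
  proof (cases "x = 0")
    case True
    have "u \<noteq> 0"
      using uv by (cases u) auto
    with True d show ?thesis
      by (simp add: power_0_left)
  next
    case False
    have "(x ^ d) ^ u = x ^ ((CARD('a) - 1) * v + 1)"
      by (simp only: uv flip: power_mult)
    then show ?thesis
      using power_card_minus_1[OF False] by (simp only: power_add power_mult) simp
  qed
  then show ?thesis
    by (metis injI)
qed

text \<open>The factor of \<open>d\<close> that is a power of \<open>p\<close> gives an additive
  bijection and can be removed. For the remaining \<open>s\<close> the identity holds between
  polynomials, as their degrees are below q; if \<open>s > 1\<close>, its linear coefficient says
  that \<open>p\<close> divides \<open>s\<close>.\<close>

lemma additive_power_imp_prime_power: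
  assumes p: "prime p" "CHAR('a :: {field, finite}) = p"
    and d: "1 \<le> d" "d \<le> CARD('a) - 1" and add: "\<And>x :: 'a. (x + 1) ^ d = x ^ d + 1"
  shows "\<exists>t. d = p ^ t"
proof -
  have "d \<noteq> 0" "\<not> is_unit p"
    using d(1) p(1) by auto
  then obtain s where s: "d = p ^ multiplicity p d * s" "\<not> p dvd s"
    by (rule multiplicity_decompose')
  define t where "t = multiplicity p d"
  define P where "P = p ^ t"
  have d_eq: "d = P * s"
    using s(1) by (simp add: P_def t_def)
  have P: "P \<ge> 1"
    using prime_gt_0_nat[OF p(1)] by (simp add: P_def Suc_leI)
  have frob: "(x + y) ^ P = x ^ P + y ^ P" for x y :: 'a
    using freshmans_dream'[of P t x y] p by (simp add: P_def)
  have "inj (\<lambda>x :: 'a. x ^ P)"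
  proof (rule injI)
    fix x y :: 'a
    assume "x ^ P = y ^ P"
    then have "(x - y) ^ P = 0"
      using frob[of "x - y" y] by simp
    then show "x = y"
      using P by simp
  qed
  then have surj: "surj (\<lambda>x :: 'a. x ^ P)"
    by (simp add: finite_UNIV_inj_surj)
  have add_s: "(y + 1) ^ s = y ^ s + 1" for y :: 'a
  proof -
    obtain x where "y = x ^ P"
      using surj by (metis surjE)
    then show ?thesis
      using add[of x] frob[of x 1] by (simp add: d_eq power_mult)
  qed
  have "1 \<le> s"
    using d(1) d_eq by (cases s) auto
  have "s \<le> d"
    using P d_eq by simp
  have "s = 1"
  proof (rule ccontr)
    assume "s \<noteq> 1"
    then have "2 \<le> s"
      using \<open>1 \<le> s\<close> by simp
    have "[:1, 1 :: 'a:] ^ s = monom 1 s + 1"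
    proof (rule poly_eqI_degree[of UNIV])
      show "poly ([:1, 1:] ^ s) y = poly (monom 1 s + 1) y" for y :: 'a
        using add_s[of y] by (simp add: poly_monom add.commute)
      have "s < CARD('a)"
        using \<open>s \<le> d\<close> d(2) card_UNIV_ge_2[where 'a = 'a] by simp
      moreover have "degree ([:1, 1 :: 'a:] ^ s) \<le> s"
        using degree_power_le[of "[:1, 1 :: 'a:]" s] by simp
      moreover have "degree (monom 1 s + 1 :: 'a poly) \<le> s"
        by (intro degree_add_le degree_monom_le) simp
      ultimately show "degree ([:1, 1 :: 'a:] ^ s) < CARD('a)" "degree (monom 1 s + 1 :: 'a poly) < CARD('a)"
        by simp_all
    qed
    then have "coeff ([:1, 1 :: 'a:] ^ s) 1 = coeff (monom 1 s + 1) 1"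
      by simp
    then have "of_nat s = (0 :: 'a)"
      using \<open>2 \<le> s\<close> by (simp add: coeff_linear_poly_power)
    then show False
      using s(2) p(2) of_nat_eq_0_iff_char_dvd by blast
  qed
  then show ?thesis
    by (auto simp: d_eq P_def)
qed

text \<open>The matrix with rows \<open>(1, 0, a)\<close>, \<open>(0, 1, b)\<close> and \<open>(a, b, c)\<close> has determinant \<open>c - a ^ 2 - b ^ 2\<close>.\<close>
lemma even_preserves_3_imp_additive:
  fixes f :: "'a :: {field, finite} \<Rightarrow> 'a"
  assumes two: "(2 :: 'a) = 0" and f: "preserves_positive_definiteness 3 f"
    and f_0: "f 0 = 0" and surj: "surj f"
    and mult: "\<And>x. f 1 * f (x ^ 2) = f x ^ 2"
  shows "f (u + v) = f u + f v"
proof -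
  note S = even_nonzero_squares[OF two]
  have minors: "positive_definite 3 A \<longleftrightarrow> A \<in> carrier_mat 3 3 \<and> A\<^sup>T = A \<and>
      leading_principal_minor A 1 \<noteq> 0 \<and> leading_principal_minor A 2 \<noteq> 0 \<and> leading_principal_minor A 3 \<noteq> 0"
    for A :: "'a mat"
  proof -
    have "{1..3 :: nat} = {1, 2, 3}"
      by auto
    then show ?thesis
      by (simp add: positive_definite_def S)
  qed
  have f_1: "f 1 \<noteq> 0"
  proof
    assume "f 1 = 0"
    then have "f x = 0" for x
      using mult[of x] by simp
    then show False
      using surj by (metis surjE zero_neq_one)
  qed
  have ne: "f c \<noteq> f (a ^ 2) + f (b ^ 2)" if c: "c \<noteq> a ^ 2 + b ^ 2" for a b c
  proof
    assume eq: "f c = f (a ^ 2) + f (b ^ 2)"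
    define g :: "nat \<times> nat \<Rightarrow> 'a" where "g = (\<lambda>(i, j).
      if i = j then if i = 2 then c else 1
      else if i + j = 2 then a else if i + j = 3 then b else 0)"
    define A where "A = mat 3 3 g"
    have cA: "A \<in> carrier_mat 3 3" and cfA: "map_mat f A \<in> carrier_mat 3 3"
      by (simp_all add: A_def)
    have sym: "A\<^sup>T = A"
      by (rule eq_matI) (auto simp: A_def g_def add.commute)
    have "leading_principal_minor A 1 = 1"
      using leading_principal_minor_eq[OF cA, of 1] by (simp add: det_single A_def g_def)
    moreover have "leading_principal_minor A 2 = 1"
      using leading_principal_minor_eq[OF cA, of 2] by (simp add: det_mat_2 A_def g_def)
    moreover have "leading_principal_minor A 3 = c - (a ^ 2 + b ^ 2)"
      using leading_principal_minor_eq[OF cA, of 3]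
      by (simp add: det_mat_3 A_def g_def power2_eq_square algebra_simps)
    ultimately have "positive_definite 3 A"
      using c cA sym by (simp add: minors)
    then have "positive_definite 3 (map_mat f A)"
      using f by (simp add: preserves_positive_definiteness_def)
    then have "leading_principal_minor (map_mat f A) 3 \<noteq> 0"
      by (simp add: minors)
    moreover have "leading_principal_minor (map_mat f A) 3 = f 1 * (f 1 * f c - f a ^ 2 - f b ^ 2)"
      using leading_principal_minor_eq[OF cfA, of 3]
      by (simp add: det_mat_3 A_def g_def f_0 power2_eq_square algebra_simps)
    moreover have "f 1 * f c - f a ^ 2 - f b ^ 2 = 0"
      by (simp add: eq mult[symmetric] distrib_left)
    ultimately show False
      by (metis mult_zero_right)
  qed
  obtain a b where ab: "u = a ^ 2" "v = b ^ 2"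
    using even_ex_sqrt[OF two, of u] even_ex_sqrt[OF two, of v] by blast
  \<comment> \<open>Preservation only excludes values; surjectivity provides an argument
    \<open>z\<close>, which \<open>ne\<close> then identifies.\<close>
  obtain z where z: "f u + f v = f z"
    using surj by (metis surjE)
  then have "z = u + v"
    using ne[of z a b] ab by metis
  then show ?thesis
    using z by simp
qed

section \<open>Classification\<close>

lemma CHAR_eq_if_card_prime_power:
  assumes "prime p" "CARD('a :: {field, finite}) = p ^ k"
  shows "CHAR('a) = p"
proof -
  have "of_nat p ^ k = (0 :: 'a)"
    using of_nat_card_UNIV[where 'a = 'a] assms(2) by simp
  then have "CHAR('a) dvd p"
    by (simp add: of_nat_eq_0_iff_char_dvd[symmetric])
  moreover have "CHAR('a) \<noteq> 1"
  proof
    assume "CHAR('a) = 1"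
    then have "of_nat 1 = (0 :: 'a)"
      using of_nat_CHAR[where 'a = 'a] by metis
    then show False
      by simp
  qed
  ultimately show ?thesis
    using assms(1) by (metis prime_nat_iff)
qed

lemma odd_preserves_pd2_imp_frobenius:
  fixes f :: "'a :: {field, finite} \<Rightarrow> 'a"
  assumes p: "prime p" "odd p" "CARD('a) = p ^ k" and f: "preserves_pd2 f"
  shows "\<exists>c j. c \<in> nonzero_squares \<and> j \<le> k - 1 \<and> (\<forall>x. f x = c * x ^ p ^ j)"
proof -
  have char: "CHAR('a) = p"
    using p(1,3) by (rule CHAR_eq_if_card_prime_power)
  have two: "(2 :: 'a) \<noteq> 0"
    by (rule two_neq_0_if_odd_CHAR[OF p(1) char p(2)])
  have f_1: "f 1 \<in> nonzero_squares"
    by (rule preserves_pd2D(2)[OF f]) simp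
  define g where "g x = f x / f 1" for x
  have g: "preserves_pd2 g"
    unfolding g_def using f by (rule preserves_pd2_normalize)
  have g_1: "g 1 = 1"
    using f_1 unfolding g_def by (metis divide_self zero_notin_nonzero_squares)
  note * = bij_preserves_pd2_imp_multiplicative[OF two g preserves_pd2_imp_bij[OF two g] g_1]
  obtain d where d: "1 \<le> d" "d \<le> CARD('a) - 1" "\<And>x. g x = x ^ d"
    using multiplicative_imp_power[OF *(2,1) g_1] by auto
  have "(x ^ d - y ^ d) / (x - y) \<in> nonzero_squares" if "x \<noteq> y" for x y :: 'a
    using *(3)[OF that] by (simp only: d(3))
  then obtain t where t: "d = p ^ t"
    using power_directions_squares_imp_prime_power[OF p(1) char p(2) d(1,2)] by blast
  have "d < CARD('a)"
    using d(2) card_UNIV_ge_2[where 'a = 'a] by linarith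
  then have "t < k"
    unfolding t p(3) by (rule power_less_imp_less_exp[OF prime_gt_1_nat[OF p(1)]])
  have f_eq: "f x = f 1 * x ^ p ^ t" for x
  proof -
    have "f 1 \<noteq> 0"
      using f_1 by auto
    then have "f x = f 1 * g x"
      by (simp add: g_def)
    then show ?thesis
      by (simp only: d(3) t)
  qed
  show ?thesis
  proof (intro exI conjI allI)
    show "f 1 \<in> nonzero_squares"
      by (rule f_1)
    show "t \<le> k - 1"
      using \<open>t < k\<close> by simp
    show "f x = f 1 * x ^ p ^ t" for x
      by (rule f_eq)
  qed
qed

text \<open>Injectivity is recorded beside the exponent: it yields the gcd condition for
  \<open>n = 2\<close> and the surjectivity of \<open>f\<close> for \<open>n = 3\<close>.\<close>

lemma even_preserves_pd2_imp_power:
  fixes f :: "'a :: {field, finite} \<Rightarrow> 'a"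
  assumes two: "(2 :: 'a) = 0" and f: "preserves_pd2 f"
  shows "\<exists>c d. c \<noteq> 0 \<and> 1 \<le> d \<and> d \<le> CARD('a) - 1 \<and> inj (\<lambda>x :: 'a. x ^ d) \<and>
    (\<forall>x. f x = c * x ^ d)"
proof -
  have f_1: "f 1 \<noteq> 0"
    using preserves_pd2D(2)[OF f, of 1] by auto
  define g where "g x = f x / f 1" for x
  have g: "preserves_pd2 g"
    unfolding g_def using f by (rule preserves_pd2_normalize)
  have g_1: "g 1 = 1"
    using f_1 by (simp add: g_def)
  note * = even_preserves_pd2_imp_multiplicative[OF two g g_1]
  obtain d where d: "1 \<le> d" "d \<le> CARD('a) - 1" "\<And>x. g x = x ^ d"
    using multiplicative_imp_power[OF *(3,2) g_1] by auto
  show ?thesis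
  proof (intro exI[of _ "f 1"] exI[of _ d] conjI allI)
    show "inj (\<lambda>x :: 'a. x ^ d)"
      using *(1) by (simp add: d(3) inj_def)
    show "f x = f 1 * x ^ d" for x
    proof -
      have "f x = f 1 * g x"
        using f_1 by (simp add: g_def)
      then show ?thesis
        by (simp only: d(3))
    qed
  qed (use f_1 d in auto)
qed

lemma even_preserves_pd2_iff:
  fixes f :: "'a :: {field, finite} \<Rightarrow> 'a"
  assumes two: "(2 :: 'a) = 0"
  shows "preserves_pd2 f \<longleftrightarrow> (\<exists>c m. c \<noteq> 0 \<and> 1 \<le> m \<and> m \<le> CARD('a) - 1 \<and>
    gcd m (CARD('a) - 1) = 1 \<and> (\<forall>x. f x = c * x ^ m))"
proof
  assume "preserves_pd2 f"
  from even_preserves_pd2_imp_power[OF two this]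
  obtain c d where "c \<noteq> 0" and d: "1 \<le> d" "d \<le> CARD('a) - 1" "inj (\<lambda>x :: 'a. x ^ d)"
    and "\<forall>x. f x = c * x ^ d"
    by (elim exE conjE) (rule that)
  moreover have "gcd d (CARD('a) - 1) = 1"
    using d(1,3) by (rule inj_power_imp_coprime)
  ultimately show "\<exists>c m. c \<noteq> 0 \<and> 1 \<le> m \<and> m \<le> CARD('a) - 1 \<and>
    gcd m (CARD('a) - 1) = 1 \<and> (\<forall>x. f x = c * x ^ m)"
    by (intro exI[of _ c] exI[of _ d] conjI)
next
  assume "\<exists>c m. c \<noteq> 0 \<and> 1 \<le> m \<and> m \<le> CARD('a) - 1 \<and>
    gcd m (CARD('a) - 1) = 1 \<and> (\<forall>x. f x = c * x ^ m)"
  then obtain c m where c: "c \<noteq> 0" and m: "1 \<le> m" "gcd m (CARD('a) - 1) = 1"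
    and f: "\<forall>x. f x = c * x ^ m"
    by (elim exE conjE) (rule that)
  have inj: "inj (\<lambda>x :: 'a. x ^ m)"
    using m by (rule coprime_imp_inj_power)
  show "preserves_pd2 f"
    unfolding preserves_pd2_def even_nonzero_squares[OF two]
  proof (intro allI impI conjI notI)
    fix a b z :: 'a
    assume *: "a \<noteq> 0 \<and> a * z - b ^ 2 \<noteq> 0"
    then show False if "f a = 0"
      using that c by (simp add: f)
    assume "f a * f z - f b ^ 2 = 0"
    then have "c ^ 2 * (a * z) ^ m = c ^ 2 * (b ^ 2) ^ m"
      by (simp add: f power2_eq_square power_mult_distrib mult_ac)
    then have "a * z = b ^ 2"
      using c injD[OF inj, of "a * z" "b ^ 2"] by simp
    with * show False
      by simp
  qed
qed

lemma even_preserves_3_imp_frobenius: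
  fixes f :: "'a :: {field, finite} \<Rightarrow> 'a"
  assumes card: "CARD('a) = 2 ^ k" and f: "preserves_positive_definiteness 3 f"
  shows "\<exists>c j. c \<noteq> 0 \<and> j \<le> k - 1 \<and> (\<forall>x. f x = c * x ^ 2 ^ j)"
proof -
  have char: "CHAR('a) = 2"
    by (rule CHAR_eq_if_card_prime_power[OF two_is_prime_nat card])
  have two: "(2 :: 'a) = 0"
    using of_nat_CHAR[where 'a = 'a] by (simp add: char)
  have "preserves_pd2 f"
    using preserves_positive_definiteness_mono[OF f, of 2]
    by (simp add: preserves_positive_definiteness_2_iff)
  from even_preserves_pd2_imp_power[OF two this]
  obtain c d where c: "c \<noteq> 0" and d: "1 \<le> d" "d \<le> CARD('a) - 1" "inj (\<lambda>x :: 'a. x ^ d)"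
    and f_eq: "\<forall>x. f x = c * x ^ d"
    by (elim exE conjE) (rule that)
  have "inj f"
    using d(3) c by (simp add: inj_def f_eq)
  then have "surj f"
    by (simp add: finite_UNIV_inj_surj)
  have "f (x + 1) = f x + f 1" for x
  proof (rule even_preserves_3_imp_additive[OF two f _ \<open>surj f\<close>])
    show "f 0 = 0"
      using d(1) by (simp add: f_eq power_0_left)
    show "f 1 * f (x ^ 2) = f x ^ 2" for x
      by (simp add: f_eq power2_eq_square power_mult_distrib mult_ac)
  qed
  then have "c * (x + 1) ^ d = c * (x ^ d + 1)" for x
    by (simp add: f_eq distrib_left)
  then have "(x + 1) ^ d = x ^ d + 1" for x :: 'a
    using c by simp
  then obtain t where t: "d = 2 ^ t"
    using additive_power_imp_prime_power[OF two_is_prime_nat char d(1,2)] by blast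
  have "d < CARD('a)"
    using d(2) card_UNIV_ge_2[where 'a = 'a] by linarith
  then have "t < k"
    by (simp add: t card)
  with c show ?thesis
    by (intro exI[of _ c] exI[of _ t]) (auto simp: f_eq t)
qed

theorem theorem1p2:
  fixes p k q n :: nat and f :: "'a :: {field, finite} \<Rightarrow> 'a"
  assumes "prime p" and "k \<ge> 1" and "q = p ^ k" and "card (UNIV :: 'a set) = q" and "n \<ge> 1"
  shows
    "(n = 1 \<longrightarrow>
        (preserves_positive_definiteness n f \<longleftrightarrow>
          f ` nonzero_squares \<subseteq> nonzero_squares)) \<and>
     (n = 2 \<and> even q \<longrightarrow>
        (preserves_positive_definiteness n f \<longleftrightarrow>
          (\<exists>c m. c \<noteq> 0 \<and> 1 \<le> m \<and> m \<le> q - 1 \<and> gcd m (q - 1) = 1 \<and>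
                 (\<forall>x. f x = c * x ^ m)))) \<and>
     (n \<ge> 3 \<and> even q \<longrightarrow>
        (preserves_positive_definiteness n f \<longleftrightarrow>
          (\<exists>c j. c \<noteq> 0 \<and> j \<le> k - 1 \<and> (\<forall>x. f x = c * x ^ (2 ^ j))))) \<and>
     (n \<ge> 2 \<and> odd q \<longrightarrow>
        (preserves_positive_definiteness n f \<longleftrightarrow>
          (\<exists>c j. c \<in> nonzero_squares \<and> j \<le> k - 1 \<and> (\<forall>x. f x = c * x ^ (p ^ j)))))"
proof (intro conjI impI)
  have card: "CARD('a) = p ^ k"
    using assms(3,4) by simp
  have char: "CHAR('a) = p"
    by (rule CHAR_eq_if_card_prime_power[OF assms(1) card])
  have char_2: "p = 2 \<and> (2 :: 'a) = 0" if "even q"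
  proof -
    have "p = 2"
      using that assms(1,3) by (metis even_power primes_dvd_imp_eq two_is_prime_nat)
    then show ?thesis
      using of_nat_CHAR[where 'a = 'a] by (simp add: char)
  qed
  show "preserves_positive_definiteness n f \<longleftrightarrow> f ` nonzero_squares \<subseteq> nonzero_squares" if "n = 1"
    using preserves_positive_definiteness_1_iff[of f] that by simp
  show "preserves_positive_definiteness n f \<longleftrightarrow> (\<exists>c m. c \<noteq> 0 \<and> 1 \<le> m \<and> m \<le> q - 1 \<and>
      gcd m (q - 1) = 1 \<and> (\<forall>x. f x = c * x ^ m))" if "n = 2 \<and> even q"
    using even_preserves_pd2_iff[of f] char_2 that assms(4)
    by (simp add: preserves_positive_definiteness_2_iff)
  show "preserves_positive_definiteness n f \<longleftrightarrow>
      (\<exists>c j. c \<noteq> 0 \<and> j \<le> k - 1 \<and> (\<forall>x. f x = c * x ^ (2 ^ j)))" if n: "n \<ge> 3 \<and> even q"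
  proof
    have p2: "p = 2" and two: "(2 :: 'a) = 0"
      using char_2 n by auto
    show "\<exists>c j. c \<noteq> 0 \<and> j \<le> k - 1 \<and> (\<forall>x. f x = c * x ^ (2 ^ j))"
      if "preserves_positive_definiteness n f"
      using even_preserves_3_imp_frobenius[of k f] preserves_positive_definiteness_mono[OF that, of 3] n card p2
      by simp
    assume "\<exists>c j. c \<noteq> 0 \<and> j \<le> k - 1 \<and> (\<forall>x. f x = c * x ^ (2 ^ j))"
    then obtain c j where "c \<noteq> 0" "\<And>x. f x = c * x ^ 2 ^ j"
      by blast
    then show "preserves_positive_definiteness n f"
      using char p2 by (intro preserves_positive_definiteness_frobenius[of 2 c f j])
        (simp_all add: even_nonzero_squares[OF two])
  qed
  show "preserves_positive_definiteness n f \<longleftrightarrow>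
      (\<exists>c j. c \<in> nonzero_squares \<and> j \<le> k - 1 \<and> (\<forall>x. f x = c * x ^ (p ^ j)))" if n: "n \<ge> 2 \<and> odd q"
  proof
    have "odd p"
      using n assms(2,3) by simp
    show "\<exists>c j. c \<in> nonzero_squares \<and> j \<le> k - 1 \<and> (\<forall>x. f x = c * x ^ (p ^ j))"
      if "preserves_positive_definiteness n f"
      using preserves_positive_definiteness_mono[OF that, of 2] n
      by (intro odd_preserves_pd2_imp_frobenius[OF assms(1) \<open>odd p\<close> card])
        (simp add: preserves_positive_definiteness_2_iff)
    show "preserves_positive_definiteness n f"
      if "\<exists>c j. c \<in> nonzero_squares \<and> j \<le> k - 1 \<and> (\<forall>x. f x = c * x ^ (p ^ j))"
      using that preserves_positive_definiteness_frobenius[OF assms(1) char] by blast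
  qed
qed

end
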